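(* Let $\mathcal U\in\mathfrak U(A_1B_1,A_1'B_1')$ and $\mathcal V\in\mathfrak U(A_2B_2,A_2'B_2')$ be bipartite unitary channels between finite-dimensional systems. Regard $\mathcal U\otimes\mathcal V$ as a bipartite unitary channel with Alice's input $A=A_1A_2$ and output $A'=A_1'A_2'$, and Bob's input $B=B_1B_2$ and output $B'=B_1'B_2'$. Then $$\Sigma(\mathcal U\otimes\mathcal V)\ge\Sigma(\mathcal U)\qquad\text{and}\qquad C(\mathcal U\otimes\mathcal V)\ge C(\mathcal U).$$
   Context: All systems are finite-dimensional quantum systems; system $X$ has complex Hilbert space $\mathcal H_X$ of dimension $d_X$, and the composite system $XY$ has Hilbert space $\mathcal H_X\otimes\mathcal H_Y$. $\mathsf{St}(X)$ is the set of density operators on $\mathcal H_X$. $\mathfrak C(X,Y)$ is the set of quantum channels (completely positive trace-preserving linear maps) from operators on $\mathcal H_X$ to operators on $\mathcal H_Y$, and $\mathfrak C(X)=\mathfrak C(X,X)$. $\mathcal I_X$ is the identity channel on $X$. $\mathfrak U(AB,A'B')$ is the set of unitary channels $\rho\mapsto U\rho U^\dagger$ with $U:\mathcal H_A\otimes\mathcal H_B\to\mathcal H_{A'}\otimes\mathcal H_{B'}$ unitary. $\|X\|_1=\mathrm{Tr}\sqrt{X^\dagger X}$. For a Hermitian-preserving linear map $\mathcal L$ with input system $X$, the diamond norm is $\|\mathcal L\|_\diamond=\sup_{\rho\in\mathsf{St}(EX)}\|(\mathcal I_E\otimes\mathcal L)(\rho)\|_1$ with $E\cong X$. For $\mathcal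 U\in\mathfrak U(AB,A'B')$, the channel $\mathcal T(\mathcal U)\in\mathfrak C(AA'B')$ is $\mathcal T(\mathcal U)=(\mathcal I_A\otimes\mathcal U)\circ(\mathcal S_{AA}\otimes\mathcal I_B)\circ(\mathcal I_A\otimes\mathcal U^{-1})$, where $\mathcal S_{AA}$ is the swap of two copies of $A$. The signalling (from $A$ to $B'$) and the causal influence (from $A$ to $B'$) of $\mathcal U$ are $$\Sigma(\mathcal U)=\inf_{\mathcal C\in\mathfrak C(B,B')}\|(\mathrm{Tr}_{A'}\otimes\mathcal I_{B'})\circ\mathcal U-\mathrm{Tr}_A\otimes\mathcal C\|_\diamond,\qquad C(\mathcal U)=\inf_{\mathcal C\in\mathfrak C(AA')}\|\mathcal T(\mathcal U)-\mathcal C\otimes\mathcal I_{B'}\|_\diamond .$$ *)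

theory Defs
  imports "HOL-Analysis.Analysis"
begin

text \<open>A system of dimension d is a finite index type with d elements, labelling a fixed orthonormal
  basis; its Hilbert space is \<open>complex^'x\<close>. The composite of systems \<open>'x\<close> and \<open>'y\<close> is
  \<open>'x \<times> 'y\<close>, and the trivial one-dimensional system is \<open>unit\<close>.\<close>

type_synonym 'x operator = "complex^'x^'x"
type_synonym ('x, 'y) superop = "'x operator \<Rightarrow> 'y operator"

subsection \<open>Operators\<close>

definition dagger :: "complex^'x^'y \<Rightarrow> complex^'y^'x" where
  "dagger A = (\<chi> i j. cnj (A $ j $ i))"

definition cinner :: "complex^'x \<Rightarrow> complex^'x \<Rightarrow> complex" where
  "cinner v w = (\<Sum>i\<in>UNIV. cnj (v $ i) * w $ i)"

definition op_scale :: "complex \<Rightarrow> 'x::finite operator \<Rightarrow> 'x operator" where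
  "op_scale c A = (\<chi> i j. c * A $ i $ j)"

definition op_unit :: "'x \<Rightarrow> 'x \<Rightarrow> 'x::finite operator" where
  "op_unit k l = (\<chi> i j. if i = k \<and> j = l then 1 else 0)"

definition op_tensor :: "'x::finite operator \<Rightarrow> 'y::finite operator \<Rightarrow> ('x \<times> 'y) operator" where
  "op_tensor A B = (\<chi> i j. A $ fst i $ fst j * B $ snd i $ snd j)"

definition psd :: "'x::finite operator \<Rightarrow> bool" where
  "psd A \<longleftrightarrow> (\<forall>v. cinner v (A *v v) \<in> \<real>\<^sub>\<ge>\<^sub>0)"

definition psd_sqrt :: "'x::finite operator \<Rightarrow> 'x operator" where
  "psd_sqrt A = (THE S. psd S \<and> S ** S = A)"

definition trace_norm :: "'x::finite operator \<Rightarrow> real" where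
  "trace_norm A = Re (trace (psd_sqrt (dagger A ** A)))"

definition states :: "'x::finite operator set" where
  "states = {\<rho>. psd \<rho> \<and> trace \<rho> = 1}"

definition unitary :: "complex^'x^'y \<Rightarrow> bool" where
  "unitary U \<longleftrightarrow> dagger U ** U = mat 1 \<and> U ** dagger U = mat 1"

subsection \<open>Maps on operators\<close>

definition op_linear :: "('x::finite, 'y::finite) superop \<Rightarrow> bool" where
  "op_linear F \<longleftrightarrow> Vector_Spaces.linear op_scale op_scale F"

text \<open>An operator on the tensor product of \<open>\<complex>\<^sup>n\<close> with a system is encoded as the family of its
  blocks \<open>M i j\<close> for \<open>i, j < n\<close>, so that the identity on the ancilla tensored with \<open>F\<close> acts by applying
  \<open>F\<close> to every block. The ancilla dimension \<open>n\<close> can thus be quantified over in complete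
  positivity.\<close>

definition block_psd :: "nat \<Rightarrow> (nat \<Rightarrow> nat \<Rightarrow> 'x::finite operator) \<Rightarrow> bool" where
  "block_psd n M \<longleftrightarrow>
     (\<forall>v :: nat \<Rightarrow> complex^'x. (\<Sum>i<n. \<Sum>j<n. cinner (v i) (M i j *v v j)) \<in> \<real>\<^sub>\<ge>\<^sub>0)"

definition completely_positive :: "('x::finite, 'y::finite) superop \<Rightarrow> bool" where
  "completely_positive F \<longleftrightarrow> (\<forall>n M. block_psd n M \<longrightarrow> block_psd n (\<lambda>i j. F (M i j)))"

definition trace_preserving :: "('x::finite, 'y::finite) superop \<Rightarrow> bool" where
  "trace_preserving F \<longleftrightarrow> (\<forall>X. trace (F X) = trace X)"

definition channels :: "('x::finite, 'y::finite) superop set" where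
  "channels = {F. op_linear F \<and> completely_positive F \<and> trace_preserving F}"

definition conj_by :: "complex^'x^'y \<Rightarrow> ('x::finite, 'y::finite) superop" where
  "conj_by U X = U ** X ** dagger U"

definition unitary_channels :: "('x::finite, 'y::finite) superop set" where
  "unitary_channels = {conj_by U | U. unitary U}"

text \<open>The tensor product of two linear maps, by linear extension from products of matrix units;
  see \<open>tensor_map_op_tensor\<close> below.\<close>

definition tensor_map ::
  "('w::finite, 'x::finite) superop \<Rightarrow> ('y::finite, 'z::finite) superop \<Rightarrow>
   ('w \<times> 'y, 'x \<times> 'z) superop" where
  "tensor_map F G X =
     (\<Sum>i\<in>UNIV. \<Sum>j\<in>UNIV. op_scale (X $ i $ j)
        (op_tensor (F (op_unit (fst i) (fst j))) (G (op_unit (snd i) (snd j)))))"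

definition trace_map :: "('x::finite, unit) superop" where
  "trace_map X = (\<chi> i j. trace X)"

definition diamond_norm :: "('x::finite, 'y::finite) superop \<Rightarrow> real" where
  "diamond_norm L = (SUP \<rho>\<in>(states :: ('x \<times> 'x) operator set). trace_norm (tensor_map id L \<rho>))"

text \<open>\<open>relabel f\<close> is conjugation by the permutation of basis vectors that sends the basis vector
  labelled \<open>f i\<close> to the one labelled \<open>i\<close>; it is only used for bijective \<open>f\<close>.\<close>

definition relabel :: "('y \<Rightarrow> 'x) \<Rightarrow> ('x::finite, 'y::finite) superop" where
  "relabel f X = (\<chi> i j. X $ f i $ f j)"

definition swap_map :: "('x::finite \<times> 'x, 'x \<times> 'x) superop" where
  "swap_map = relabel prod.swap"

definition assoc_left :: "('x::finite \<times> ('y::finite \<times> 'z::finite), ('x \<times> 'y) \<times> 'z) superop" where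
  "assoc_left = relabel (\<lambda>((x, y), z). (x, (y, z)))"

definition assoc_right :: "(('x::finite \<times> 'y::finite) \<times> 'z::finite, 'x \<times> ('y \<times> 'z)) superop" where
  "assoc_right = relabel (\<lambda>(x, (y, z)). ((x, y), z))"

definition interchange ::
  "(('w::finite \<times> 'x::finite) \<times> ('y::finite \<times> 'z::finite), ('w \<times> 'y) \<times> ('x \<times> 'z)) superop" where
  "interchange = relabel (\<lambda>((w, y), (x, z)). ((w, x), (y, z)))"

subsection \<open>Bipartite unitary channels, signalling and causal influence\<close>

text \<open>Throughout, a bipartite channel has input \<open>'a \<times> 'b\<close> and output \<open>'c \<times> 'd\<close>, where
  \<open>'a\<close>, \<open>'b\<close>, \<open>'c\<close>, \<open>'d\<close> stand for \<open>A\<close>, \<open>B\<close>, \<open>A'\<close>, \<open>B'\<close>.\<close>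

definition bipartite_tensor ::
  "('a1::finite \<times> 'b1::finite, 'c1::finite \<times> 'd1::finite) superop \<Rightarrow>
   ('a2::finite \<times> 'b2::finite, 'c2::finite \<times> 'd2::finite) superop \<Rightarrow>
   (('a1 \<times> 'a2) \<times> ('b1 \<times> 'b2), ('c1 \<times> 'c2) \<times> ('d1 \<times> 'd2)) superop" where
  "bipartite_tensor U V = interchange \<circ> tensor_map U V \<circ> interchange"

definition signalling :: "('a::finite \<times> 'b::finite, 'c::finite \<times> 'd::finite) superop \<Rightarrow> real" where
  "signalling U =
     (INF C\<in>(channels :: ('b, 'd) superop set).
        diamond_norm (\<lambda>X. tensor_map (trace_map :: ('c, unit) superop) id (U X)
                          - tensor_map (trace_map :: ('a, unit) superop) C X))"

definition T_channel ::
  "('a::finite \<times> 'b::finite, 'c::finite \<times> 'd::finite) superop \<Rightarrow>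
   ('a \<times> ('c \<times> 'd), 'a \<times> ('c \<times> 'd)) superop" where
  "T_channel U =
     tensor_map id U
       \<circ> (assoc_right \<circ> tensor_map swap_map id \<circ> assoc_left)
       \<circ> tensor_map id (inv U)"

definition causal_influence ::
  "('a::finite \<times> 'b::finite, 'c::finite \<times> 'd::finite) superop \<Rightarrow> real" where
  "causal_influence U =
     (INF C\<in>(channels :: ('a \<times> 'c, 'a \<times> 'c) superop set).
        diamond_norm (\<lambda>X. T_channel U X - (assoc_right \<circ> tensor_map C id \<circ> assoc_left) X))"

subsection \<open>Basic facts about the encoding\<close>

lemma op_unit_decomp:
  fixes X :: "'x::finite operator"
  shows "X = (\<Sum>k\<in>UNIV. \<Sum>l\<in>UNIV. op_scale (X $ k $ l) (op_unit k l))"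
proof -
  have "(\<Sum>k\<in>UNIV. \<Sum>l\<in>UNIV. op_scale (X $ k $ l) (op_unit k l) $ i $ j) = X $ i $ j" for i j
  proof -
    have "(\<Sum>k\<in>UNIV. \<Sum>l\<in>UNIV. op_scale (X $ k $ l) (op_unit k l) $ i $ j)
        = (\<Sum>k\<in>UNIV. if k = i then (\<Sum>l\<in>UNIV. if l = j then X $ k $ l else 0) else 0)"
      by (intro sum.cong refl) (auto simp: op_scale_def op_unit_def if_distrib cong: if_cong
          intro!: sum.cong sum.neutral)
    then show ?thesis by simp
  qed
  then show ?thesis by (simp add: vec_eq_iff)
qed

lemma op_linear_decomp:
  assumes "op_linear F"
  shows "F X $ p $ q = (\<Sum>k\<in>UNIV. \<Sum>l\<in>UNIV. X $ k $ l * F (op_unit k l) $ p $ q)"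
proof -
  interpret Vector_Spaces.linear op_scale op_scale F
    using assms by (simp add: op_linear_def)
  have "F X = F (\<Sum>k\<in>UNIV. \<Sum>l\<in>UNIV. op_scale (X $ k $ l) (op_unit k l))"
    by (simp flip: op_unit_decomp)
  then have "F X = (\<Sum>k\<in>UNIV. \<Sum>l\<in>UNIV. op_scale (X $ k $ l) (F (op_unit k l)))"
    by (simp add: sum scale)
  then show ?thesis by (simp add: op_scale_def)
qed

lemma tensor_map_nth:
  "tensor_map F G X $ p $ q = (\<Sum>i\<in>UNIV. \<Sum>j\<in>UNIV. X $ i $ j *
     (F (op_unit (fst i) (fst j)) $ fst p $ fst q * G (op_unit (snd i) (snd j)) $ snd p $ snd q))"
  by (simp add: tensor_map_def op_scale_def op_tensor_def)

lemma sum_UNIV_prod: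
  "(\<Sum>i\<in>(UNIV :: ('x::finite \<times> 'y::finite) set). f i) = (\<Sum>a\<in>UNIV. \<Sum>b\<in>UNIV. f (a, b))"
  by (simp add: sum.cartesian_product flip: UNIV_Times_UNIV)

lemma tensor_map_op_tensor:
  assumes "op_linear F" "op_linear G"
  shows "tensor_map F G (op_tensor A B) = op_tensor (F A) (G B)"
proof -
  have "tensor_map F G (op_tensor A B) $ p $ q = op_tensor (F A) (G B) $ p $ q" for p q
  proof -
    define f where "f a a' = A $ a $ a' * F (op_unit a a') $ fst p $ fst q" for a a'
    define g where "g b b' = B $ b $ b' * G (op_unit b b') $ snd p $ snd q" for b b'
    have "tensor_map F G (op_tensor A B) $ p $ q
        = (\<Sum>a\<in>UNIV. \<Sum>b\<in>UNIV. \<Sum>a'\<in>UNIV. \<Sum>b'\<in>UNIV. f a a' * g b b')"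
      by (simp add: tensor_map_nth sum_UNIV_prod op_tensor_def f_def g_def mult_ac)
    also have "\<dots> = (\<Sum>a\<in>UNIV. \<Sum>a'\<in>UNIV. f a a') * (\<Sum>b\<in>UNIV. \<Sum>b'\<in>UNIV. g b b')"
      by (simp add: sum_product)
    also have "\<dots> = op_tensor (F A) (G B) $ p $ q"
      by (simp add: op_tensor_def f_def g_def op_linear_decomp[OF assms(1), of A]
          op_linear_decomp[OF assms(2), of B])
    finally show ?thesis .
  qed
  then show ?thesis by (simp add: vec_eq_iff)
qed

lemma vector_space_op_scale: "vector_space (op_scale :: complex \<Rightarrow> 'x::finite operator \<Rightarrow> 'x operator)"
  by unfold_locales (simp_all add: op_scale_def vec_eq_iff algebra_simps)

lemma op_linear_iff:
  "op_linear F \<longleftrightarrow> (\<forall>X Y. F (X + Y) = F X + F Y) \<and> (\<forall>c X. F (op_scale c X) = op_scale c (F X))"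
  by (simp add: op_linear_def Vector_Spaces.linear_iff vector_space_op_scale)

lemma dagger_dagger [simp]: "dagger (dagger A) = A"
  by (simp add: dagger_def vec_eq_iff)

lemma dagger_mult: "dagger (A ** B) = dagger B ** dagger A"
  by (simp add: dagger_def matrix_matrix_mult_def vec_eq_iff mult.commute)

lemma conj_by_nth:
  "conj_by U X $ p $ q = (\<Sum>i\<in>UNIV. \<Sum>j\<in>UNIV. X $ i $ j * (U $ p $ i * cnj (U $ q $ j)))"
proof -
  have "conj_by U X $ p $ q = (\<Sum>j\<in>UNIV. \<Sum>i\<in>UNIV. X $ i $ j * (U $ p $ i * cnj (U $ q $ j)))"
    by (simp add: conj_by_def matrix_matrix_mult_def dagger_def sum_distrib_left sum_distrib_right mult_ac)
  then show ?thesis by (subst sum.swap)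
qed

lemma conj_by_op_unit: "conj_by U (op_unit k l) $ p $ q = U $ p $ k * cnj (U $ q $ l)"
proof -
  have "conj_by U (op_unit k l) $ p $ q
      = (\<Sum>i\<in>UNIV. if i = k then (\<Sum>j\<in>UNIV. if j = l then U $ p $ i * cnj (U $ q $ j) else 0) else 0)"
    unfolding conj_by_nth by (intro sum.cong refl) (simp add: op_unit_def if_distrib if_distribR cong: if_cong)
  then show ?thesis by simp
qed

lemma conj_by_mult: "conj_by A (conj_by B X) = conj_by (A ** B) X"
  by (simp add: conj_by_def dagger_mult matrix_mul_assoc)

lemma inv_conj_by:
  assumes "unitary U"
  shows "inv (conj_by U) = conj_by (dagger U)"
proof (rule inv_equality)
  have one: "conj_by (mat 1) X = X" for X :: "'z::finite operator"
  proof -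
    have "dagger (mat 1 :: complex^'z^'z) = mat 1"
      by (auto simp: dagger_def mat_def vec_eq_iff)
    then show ?thesis by (simp add: conj_by_def)
  qed
  show "conj_by (dagger U) (conj_by U X) = X" "conj_by U (conj_by (dagger U) Y) = Y" for X Y
    using assms by (simp_all add: conj_by_mult unitary_def one)
qed

definition bipartite_kron ::
  "complex^('a1::finite \<times> 'b1::finite)^('c1::finite \<times> 'd1::finite) \<Rightarrow>
   complex^('a2::finite \<times> 'b2::finite)^('c2::finite \<times> 'd2::finite) \<Rightarrow>
   complex^(('a1 \<times> 'a2) \<times> ('b1 \<times> 'b2))^(('c1 \<times> 'c2) \<times> ('d1 \<times> 'd2))" where
  "bipartite_kron K L = (\<chi> p q. K $ (fst (fst p), fst (snd p)) $ (fst (fst q), fst (snd q))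
                               * L $ (snd (fst p), snd (snd p)) $ (snd (fst q), snd (snd q)))"

lemma bipartite_tensor_conj_by:
  "bipartite_tensor (conj_by K) (conj_by L) = conj_by (bipartite_kron K L)"
proof -
  let ?s = "\<lambda>((w, x), (y, z)). ((w, y), (x, z))"
  have bij: "bij ?s"
    by (rule o_bij[of ?s]) (auto simp: fun_eq_iff)
  have "bipartite_tensor (conj_by K) (conj_by L) X $ p $ q = conj_by (bipartite_kron K L) X $ p $ q" for X p q
  proof -
    have "bipartite_tensor (conj_by K) (conj_by L) X $ p $ q
      = (\<Sum>i\<in>UNIV. \<Sum>j\<in>UNIV. X $ ?s i $ ?s j *
           (bipartite_kron K L $ p $ ?s i * cnj (bipartite_kron K L $ q $ ?s j)))"
      by (intro sum.cong refl | simp add: bipartite_tensor_def interchange_def relabel_def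
          tensor_map_nth conj_by_op_unit bipartite_kron_def split_beta mult_ac)+
    also have "\<dots> = (\<Sum>i\<in>UNIV. \<Sum>j\<in>UNIV. X $ ?s i $ j *
           (bipartite_kron K L $ p $ ?s i * cnj (bipartite_kron K L $ q $ j)))"
      by (intro sum.cong refl sum.reindex_bij_betw[OF bij])
    also have "\<dots> = (\<Sum>i\<in>UNIV. \<Sum>j\<in>UNIV. X $ i $ j *
           (bipartite_kron K L $ p $ i * cnj (bipartite_kron K L $ q $ j)))"
      by (rule sum.reindex_bij_betw[OF bij])
    finally show ?thesis by (simp add: conj_by_nth)
  qed
  then show ?thesis by (simp add: fun_eq_iff vec_eq_iff)
qed

lemma bipartite_kron_mult:
  "bipartite_kron A B ** bipartite_kron C D = bipartite_kron (A ** C) (B ** D)"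
proof -
  have *: "(\<Sum>w\<in>UNIV. \<Sum>x\<in>UNIV. \<Sum>y\<in>UNIV. \<Sum>z\<in>UNIV. f w y * g x z)
      = (\<Sum>w\<in>UNIV. \<Sum>y\<in>UNIV. f w y) * (\<Sum>x\<in>UNIV. \<Sum>z\<in>UNIV. g x z)"
    for f :: "'w::finite \<Rightarrow> 'y::finite \<Rightarrow> complex" and g :: "'x::finite \<Rightarrow> 'z::finite \<Rightarrow> complex"
    by (simp add: sum_product)
  have "(bipartite_kron A B ** bipartite_kron C D) $ p $ q = bipartite_kron (A ** C) (B ** D) $ p $ q" for p q
    using *[of "\<lambda>w y. A $ (fst (fst p), fst (snd p)) $ (w, y) * C $ (w, y) $ (fst (fst q), fst (snd q))"
        "\<lambda>x z. B $ (snd (fst p), snd (snd p)) $ (x, z) * D $ (x, z) $ (snd (fst q), snd (snd q))"]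
    by (simp add: matrix_matrix_mult_def bipartite_kron_def sum_UNIV_prod mult_ac)
  then show ?thesis by (simp add: vec_eq_iff)
qed

lemma bipartite_kron_one: "bipartite_kron (mat 1) (mat 1) = mat 1"
  by (auto simp: bipartite_kron_def mat_def vec_eq_iff prod_eq_iff)

lemma unitary_bipartite_kron:
  assumes "unitary K" "unitary L"
  shows "unitary (bipartite_kron K L)"
proof -
  have "dagger (bipartite_kron K L) = bipartite_kron (dagger K) (dagger L)"
    by (simp add: dagger_def bipartite_kron_def vec_eq_iff)
  then show ?thesis
    using assms by (simp add: unitary_def bipartite_kron_mult bipartite_kron_one)
qed

lemma bipartite_tensor_unitary_channels:
  assumes "U \<in> unitary_channels" "V \<in> unitary_channels"
  shows "bipartite_tensor U V \<in> unitary_channels"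
  using assms by (auto simp: unitary_channels_def bipartite_tensor_conj_by intro: unitary_bipartite_kron)

end

(*
  The trace norm of Y is the maximum of Re (tr (W Y)) over unitaries W: by compactness a maximiser W
  exists, maximality under rank-one phase perturbations makes W Y positive semidefinite, and hence
  W Y is the positive square root of Y^* Y. The trace norm therefore does not increase under partial
  traces. Feeding fixed pure states into A2 and B2 (for C: into A2, A2' and B2') and tracing out the
  corresponding outputs turns U \<otimes> V into U and T(U \<otimes> V) into T(U), since T is multiplicative. The same
  operation turns every channel C competing in the infimum for U \<otimes> V into one competing in the infimum
  for U, and it does not increase the diamond norm of the difference.
*)

theory Submission
  imports Defs
begin

section \<open>Positive operators\<close>

text \<open>\<open>psd_sqrt\<close> is a definite description, so \<open>trace_norm\<close> is
  opaque until a positive root of \<open>dagger Y ** Y\<close> is exhibited and shown to be the only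
  one; the maximising unitary supplies the root, \<open>psd_sqrt_unique\<close> the rest. The
  obstacle in comparing diamond norms is that the ancilla is a copy of the input and grows with it.
  It is therefore embedded along with the input, and afterwards only the ancilla labels in the image
  of the embedding are read off. This is a compression followed by a partial trace, which is why
  contractivity of the trace norm is established for merely injective factorizations
  \<open>g\<close>. Competing channels need more care: discarding must preserve their trace, so
  there the factorizations are bijective. Suprema and infima are taken in the reals, so boundedness
  and nonemptiness are part of the argument.\<close>

lemma cinner_self: "cinner v v = complex_of_real ((norm v)\<^sup>2)"
proof -
  have "(norm v)\<^sup>2 = (\<Sum>i\<in>UNIV. (norm (v $ i))\<^sup>2)"
    by (simp add: norm_vec_def L2_set_def sum_nonneg)
  then show ?thesis
    by (simp only: cinner_def complex_norm_square of_real_sum) (simp add: mult.commute)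
qed

lemma cinner_add_left: "cinner (u + v) w = cinner u w + cinner v w"
  by (simp add: cinner_def algebra_simps sum.distrib)

lemma cinner_add_right: "cinner u (v + w) = cinner u v + cinner u w"
  by (simp add: cinner_def algebra_simps sum.distrib)

lemma cinner_scale_left: "cinner (c *s v) w = cnj c * cinner v w"
  by (simp add: cinner_def sum_distrib_left mult_ac)

lemma cinner_scale_right: "cinner v (c *s w) = c * cinner v w"
  by (simp add: cinner_def sum_distrib_left mult_ac)

lemma cnj_cinner: "cnj (cinner v w) = cinner w v"
  by (simp add: cinner_def mult.commute)

lemma cinner_dagger: "cinner v (A *v w) = cinner (dagger A *v v) w"
proof -
  have "cinner v (A *v w) = (\<Sum>i\<in>UNIV. \<Sum>j\<in>UNIV. cnj (v $ i) * (A $ i $ j * w $ j))"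
    by (simp add: cinner_def matrix_vector_mult_def sum_distrib_left)
  also have "\<dots> = (\<Sum>j\<in>UNIV. \<Sum>i\<in>UNIV. cnj (v $ i) * (A $ i $ j * w $ j))"
    by (rule sum.swap)
  also have "\<dots> = cinner (dagger A *v v) w"
    by (simp add: cinner_def matrix_vector_mult_def dagger_def sum_distrib_left sum_distrib_right mult_ac)
  finally show ?thesis .
qed

lemma cinner_axis: "cinner (axis i 1) v = v $ i"
  by (simp add: cinner_def axis_def if_distrib if_distribR cong: if_cong)

lemma mult_axis_nth: "(A *v axis j 1) $ i = (A $ i $ j :: complex)"
  by (simp add: matrix_vector_mult_def axis_def if_distrib cong: if_cong)

text \<open>Polarisation: the quadratic form is real at every \<open>v + c *s w\<close>, so
  \<open>c * a + cnj c * b\<close> is real for the two cross terms \<open>a\<close> and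
  \<open>b\<close>; \<open>c = 1\<close> and \<open>c = \<i>\<close> together force
  \<open>cnj a = b\<close>.\<close>

lemma psd_dagger:
  assumes "psd P"
  shows "dagger P = P"
proof -
  have real: "cinner v (P *v v) \<in> \<real>" for v
    using assms by (meson nonneg_Reals_subset_Reals psd_def subsetD)
  have sesq: "cnj (cinner v (P *v w)) = cinner w (P *v v)" for v w
  proof -
    define a where "a = cinner v (P *v w)"
    define b where "b = cinner w (P *v v)"
    have "cinner (v + c *s w) (P *v (v + c *s w)) = cinner v (P *v v) + c * a + cnj c * b
        + cnj c * c * cinner w (P *v w)" for c
      by (simp add: a_def b_def cinner_add_left cinner_add_right cinner_scale_left cinner_scale_right
          matrix_vector_right_distrib vector_scalar_commute algebra_simps)
    then have "c * a + cnj c * b \<in> \<real>" for c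
      using real[of "v + c *s w"] real[of v] real[of w]
      by (simp add: complex_is_Real_iff)
    from this[of 1] this[of \<i>] have "a + b \<in> \<real>" "\<i> * a - \<i> * b \<in> \<real>" by simp_all
    then have "cnj a = b"
      by (auto simp: complex_is_Real_iff complex_eq_iff)
    then show ?thesis by (simp add: a_def b_def)
  qed
  have "cnj (P $ j $ i) = P $ i $ j" for i j
    using sesq[of "axis j 1" "axis i 1"] by (simp add: cinner_axis mult_axis_nth)
  then show ?thesis by (simp add: dagger_def vec_eq_iff)
qed

text \<open>Moving from \<open>v\<close> by \<open>-t\<close> times \<open>S *v v\<close> changes
  the form from 0 to \<open>t * t * m - 2 * t * n\<close>. For small positive \<open>t\<close> the
  linear term wins, which contradicts positivity if \<open>n > 0\<close>.\<close>

lemma psd_kernel: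
  assumes "psd S" "cinner v (S *v v) = 0"
  shows "S *v v = 0"
proof (rule ccontr)
  assume nz: "S *v v \<noteq> 0"
  define w where "w = S *v v"
  define n where "n = (norm w)\<^sup>2"
  define m where "m = Re (cinner w (S *v w))"
  have n: "n > 0" using nz by (simp add: n_def w_def)
  have ww: "cinner v (S *v w) = of_real n"
    by (simp add: cinner_dagger psd_dagger[OF assms(1)] n_def cinner_self flip: w_def)
  have vw: "cinner v w = 0" using assms(2) by (simp add: w_def)
  have "0 \<le> t * t * m - 2 * t * n" for t
  proof -
    have "cinner (v + complex_of_real (-t) *s w) (S *v (v + complex_of_real (-t) *s w)) \<in> \<real>\<^sub>\<ge>\<^sub>0"
      using assms(1) by (simp add: psd_def)
    also have "cinner (v + complex_of_real (-t) *s w) (S *v (v + complex_of_real (-t) *s w))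
      = of_real t * of_real t * cinner w (S *v w) - 2 * of_real t * of_real n"
      by (simp only: cinner_add_left cinner_add_right cinner_scale_left cinner_scale_right
          matrix_vector_right_distrib vector_scalar_commute vw ww flip: w_def)
        (simp add: cinner_self n_def algebra_simps)
    finally show ?thesis
      by (simp add: complex_nonneg_Reals_iff m_def)
  qed
  moreover have "m \<ge> 0"
    using assms(1) by (simp add: m_def psd_def complex_nonneg_Reals_iff)
  \<comment> \<open>The choice \<open>t = n / (m + 1)\<close> makes \<open>t * m\<close> at most
    \<open>n\<close>; the 1 keeps the denominator positive when \<open>m = 0\<close>.\<close>
  moreover have "n / (m + 1) * (n / (m + 1)) * m - 2 * (n / (m + 1)) * n < 0"
  proof -
    have "n / (m + 1) * m \<le> n"
      using n \<open>m \<ge> 0\<close> by (simp add: field_simps)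
    then have "n / (m + 1) * (n / (m + 1) * m - 2 * n) < 0"
      using n \<open>m \<ge> 0\<close> by (intro mult_pos_neg) auto
    then show ?thesis by (simp add: algebra_simps)
  qed
  ultimately show False by (meson not_less)
qed

lemma trace_eq_sum_cinner: "trace A = (\<Sum>i\<in>UNIV. cinner (axis i 1) (A *v axis i 1))"
  by (simp add: trace_def cinner_axis mult_axis_nth)

lemma psd_trace: "psd P \<Longrightarrow> trace P \<in> \<real>\<^sub>\<ge>\<^sub>0"
  by (simp add: trace_eq_sum_cinner psd_def complex_nonneg_Reals_iff sum_nonneg)

lemma matrix_add_rdistrib: "(A + B) ** C = A ** C + B ** (C :: 'a::semiring_1^_^_)"
  by (simp add: matrix_matrix_mult_def vec_eq_iff sum.distrib distrib_right)

text \<open>\<open>S\<close> and \<open>R\<close> are not known to commute, so the difference of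
  squares does not simply factor. It equals \<open>R ** D + D ** S\<close> with
  \<open>D = S - R\<close>; multiplying by \<open>D\<close> and taking the trace gives two sums of
  nonnegative terms adding up to 0. By \<open>psd_kernel\<close>, \<open>R\<close> and
  \<open>S\<close> then vanish on the range of \<open>D\<close>, so \<open>D ** D\<close> is zero,
  and so is the Hermitian \<open>D\<close>.\<close>

lemma psd_sqrt_unique:
  assumes "psd S" "psd R" "S ** S = R ** R"
  shows "S = R"
proof -
  define D where "D = S - R"
  have dag: "dagger D = D"
    using psd_dagger[OF assms(1)] psd_dagger[OF assms(2)] by (simp add: D_def dagger_def vec_eq_iff)
  have S: "S = R + D" by (simp add: D_def)
  have "S ** S = R ** S + D ** S" by (metis S matrix_add_rdistrib)
  also have "R ** S = R ** R + R ** D" by (metis S matrix_add_ldistrib)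
  finally have zero: "R ** D + D ** S = 0" using assms(3) by (simp add: add.assoc)
  have "trace (D ** R ** D) + trace (D ** S ** D) = trace ((R ** D + D ** S) ** D)"
    by (simp add: matrix_add_rdistrib trace_add trace_mul_sym[of "R ** D" D] matrix_mul_assoc)
  then have "trace (D ** R ** D) + trace (D ** S ** D) = 0"
    by (simp add: zero trace_0[unfolded mat_0])
  moreover have "trace (D ** M ** D) = (\<Sum>i\<in>UNIV. cinner (D *v axis i 1) (M *v (D *v axis i 1)))" for M
    by (simp add: trace_eq_sum_cinner dag cinner_dagger[of _ D] flip: matrix_vector_mul_assoc)
  ultimately have "(\<Sum>i\<in>UNIV. cinner (D *v axis i 1) (R *v (D *v axis i 1)) + cinner (D *v axis i 1) (S *v (D *v axis i 1))) = 0"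
    by (simp add: sum.distrib)
  then have "(\<Sum>i\<in>UNIV. Re (cinner (D *v axis i 1) (R *v (D *v axis i 1)) + cinner (D *v axis i 1) (S *v (D *v axis i 1)))) = 0"
    by (metis Re_sum zero_complex.sel(1))
  then have "\<forall>i\<in>UNIV. Re (cinner (D *v axis i 1) (R *v (D *v axis i 1)) + cinner (D *v axis i 1) (S *v (D *v axis i 1))) = 0"
    using assms(1,2) by (subst (asm) sum_nonneg_eq_0_iff) (auto simp: psd_def complex_nonneg_Reals_iff)
  then have "cinner (D *v axis i 1) (R *v (D *v axis i 1)) = 0" "cinner (D *v axis i 1) (S *v (D *v axis i 1)) = 0" for i
    using assms(1,2) by (auto simp: psd_def complex_nonneg_Reals_iff complex_eq_iff add_nonneg_eq_0_iff)
  then have "R *v (D *v axis i 1) = 0" "S *v (D *v axis i 1) = 0" for i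
    using psd_kernel[OF assms(2)] psd_kernel[OF assms(1)] by blast+
  then have "D *v (D *v axis i 1) = 0" for i
    by (simp add: D_def matrix_vector_mult_diff_rdistrib)
  then have "cinner (D *v axis i 1) (D *v axis i 1) = 0" for i
    by (metis cinner_dagger dag cinner_scale_left mult_zero_left complex_cnj_zero vector_smult_lzero cinner_dagger cnj_cinner)
  then have "D *v axis i 1 = 0" for i
    by (simp add: cinner_self)
  then have "D = 0"
    by (metis mult_axis_nth vec_eq_iff zero_index)
  then show ?thesis by (simp add: D_def)
qed

text \<open>The test unitary \<open>Z\<close> multiplies \<open>v\<close> by the phase \<open>c\<close> that makes \<open>c * z\<close> equal to the modulus of
  \<open>z\<close>, and fixes the orthogonal complement of \<open>v\<close>.\<close>

lemma psd_if_trace_max: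
  assumes "\<And>Z. unitary Z \<Longrightarrow> Re (trace (Z ** P)) \<le> Re (trace P)"
  shows "psd P"
  unfolding psd_def
proof
  fix v
  define z where "z = cinner v (P *v v)"
  define n where "n = (norm v)\<^sup>2"
  show "cinner v (P *v v) \<in> \<real>\<^sub>\<ge>\<^sub>0"
  proof (cases "z = 0")
    case True then show ?thesis by (simp flip: z_def)
  next
    case False
    then have "v \<noteq> 0" by (auto simp: z_def cinner_def)
    then have n: "n > 0" by (simp add: n_def)
    have nv: "cinner v v = of_real n" by (simp add: cinner_self n_def)
    define c where "c = cnj z / norm z"
    have c: "c * cnj c = 1"
      using False by (simp add: c_def complex_norm_square[symmetric] power2_eq_square field_simps)
    \<comment> \<open>\<open>Z\<close> is the identity plus \<open>s\<close> times the rank-one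
      operator of \<open>v\<close>, so its eigenvalue on \<open>v\<close> is
      \<open>1 + s * n = c\<close>. The identity proved for \<open>s\<close> below is what makes
      \<open>Z\<close> unitary.\<close>
    define s where "s = (c - 1) / n"
    define Z :: "complex^'a^'a" where "Z = (\<chi> i j. (if i = j then 1 else 0) + s * (v $ i * cnj (v $ j)))"
    have s: "s + cnj s + cnj s * s * of_real n = 0"
      using n c by (simp add: s_def field_simps)
    have "(dagger Z ** Z) $ i $ j = mat 1 $ i $ j" for i j
    proof -
      have "(dagger Z ** Z) $ i $ j = (\<Sum>k\<in>UNIV. (if k = i then (if i = j then 1 else 0) else 0)
          + (if k = i then s * (v $ i * cnj (v $ j)) else 0)
          + (if k = j then cnj s * (v $ i * cnj (v $ j)) else 0)
          + cnj s * s * (v $ i * cnj (v $ j)) * (cnj (v $ k) * v $ k))"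
        by (subst matrix_matrix_mult_def, subst vec_lambda_beta, subst vec_lambda_beta, intro sum.cong refl)
          (auto simp: Z_def dagger_def algebra_simps)
      also have "\<dots> = (if i = j then 1 else 0) + s * (v $ i * cnj (v $ j)) + cnj s * (v $ i * cnj (v $ j))
          + cnj s * s * (v $ i * cnj (v $ j)) * cinner v v"
        by (simp add: sum.distrib cinner_def sum_distrib_left)
      also have "\<dots> = (if i = j then 1 else 0) + (s + cnj s + cnj s * s * of_real n) * (v $ i * cnj (v $ j))"
        by (simp add: nv algebra_simps)
      finally show ?thesis by (simp add: s mat_def)
    qed
    then have "dagger Z ** Z = mat 1" by (simp add: vec_eq_iff)
    then have "unitary Z" by (simp add: unitary_def matrix_left_right_inverse)
    have "trace (Z ** P) = (\<Sum>i\<in>UNIV. \<Sum>j\<in>UNIV. (if j = i then P $ i $ i else 0) + s * (cnj (v $ j) * (P $ j $ i * v $ i)))"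
      by (subst trace_def, subst matrix_matrix_mult_def, subst vec_lambda_beta, subst vec_lambda_beta, intro sum.cong refl)
        (auto simp: Z_def algebra_simps)
    also have "\<dots> = trace P + s * (\<Sum>i\<in>UNIV. \<Sum>j\<in>UNIV. (cnj (v $ j) * (P $ j $ i * v $ i)))"
      by (simp add: sum.distrib trace_def sum_distrib_left)
    also have "(\<Sum>i\<in>UNIV. \<Sum>j\<in>UNIV. (cnj (v $ j) * (P $ j $ i * v $ i))) = z"
      by (subst sum.swap) (simp add: z_def cinner_def matrix_vector_mult_def sum_distrib_left)
    \<comment> \<open>The trace changes by exactly \<open>s * z\<close>. Maximality bounds the real
      part, which after scaling by \<open>n\<close> reads \<open>norm z \<le> Re z\<close>, possible
      only for a nonnegative real \<open>z\<close>.\<close>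
    finally have "Re (s * z) \<le> 0"
      using assms[OF \<open>unitary Z\<close>] by simp
    then have "Re ((c - 1) * z) \<le> 0"
      using n by (simp add: s_def divide_le_0_iff)
    moreover have "c * z = norm z"
      using False by (simp add: c_def complex_norm_square[symmetric] power2_eq_square mult.commute)
    ultimately have "norm z \<le> Re z" by (simp add: algebra_simps)
    then have "z \<in> \<real>\<^sub>\<ge>\<^sub>0"
      using complex_Re_le_cmod[of z] norm_ge_zero[of z]
      by (simp add: complex_nonneg_Reals_iff cmod_def) (smt (verit) real_sqrt_le_iff real_sqrt_abs power2_eq_iff zero_eq_power2)
    then show ?thesis by (simp add: z_def)
  qed
qed

section \<open>Trace norm\<close>

lemma unitary_nth_le:
  assumes "unitary W"
  shows "norm (W $ i $ j) \<le> 1"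
proof -
  have "(W ** dagger W) $ i $ i = 1"
    using assms by (simp add: unitary_def mat_def)
  then have "(\<Sum>k\<in>UNIV. complex_of_real ((norm (W $ i $ k))\<^sup>2)) = 1"
    by (simp add: matrix_matrix_mult_def dagger_def complex_norm_square del: of_real_power)
  then have "(\<Sum>k\<in>UNIV. (norm (W $ i $ k))\<^sup>2) = 1"
    by (metis of_real_eq_1_iff of_real_sum)
  moreover have "(norm (W $ i $ j))\<^sup>2 \<le> (\<Sum>k\<in>UNIV. (norm (W $ i $ k))\<^sup>2)"
    by (rule member_le_sum) auto
  ultimately show ?thesis by (simp add: power_le_one_iff)
qed

lemma compact_unitary: "compact {W :: complex^'x^'x. unitary W}"
proof -
  have "bounded {W :: complex^'x^'x. unitary W}"
  proof -
    have "norm W \<le> (\<Sum>i\<in>(UNIV::'x set). \<Sum>j\<in>(UNIV::'x set). 1)" if "unitary W" for W :: "complex^'x^'x"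
    proof -
      have "norm W \<le> (\<Sum>i\<in>UNIV. norm (W $ i))"
        by (simp add: norm_vec_def L2_set_le_sum)
      also have "\<dots> \<le> (\<Sum>i\<in>UNIV. \<Sum>j\<in>UNIV. norm (W $ i $ j))"
        by (intro sum_mono) (simp add: norm_vec_def L2_set_le_sum)
      also have "\<dots> \<le> (\<Sum>i\<in>(UNIV::'x set). \<Sum>j\<in>(UNIV::'x set). 1)"
        using that by (intro sum_mono unitary_nth_le)
      finally show ?thesis .
    qed
    then show ?thesis unfolding bounded_iff by blast
  qed
  moreover have "closed {W :: complex^'x^'x. unitary W}"
    unfolding unitary_def vec_eq_iff matrix_matrix_mult_def dagger_def
    by (intro closed_Collect_conj closed_Collect_all)
      (simp, intro closed_Collect_eq continuous_intros)+
  ultimately show ?thesis by (simp add: compact_eq_bounded_closed)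
qed

lemma polar_decomposition_max:
  fixes Y :: "complex^'x^'x"
  obtains W where "unitary W" "trace_norm Y = Re (trace (W ** Y))" "psd (W ** Y)"
    "\<And>Z. unitary Z \<Longrightarrow> Re (trace (Z ** Y)) \<le> trace_norm Y"
proof -
  let ?f = "\<lambda>W. Re (trace (W ** Y))"
  have "continuous_on {W. unitary W} ?f"
    unfolding trace_def matrix_matrix_mult_def by (simp, intro continuous_intros)
  moreover have "unitary (mat 1 :: complex^'x^'x)"
  proof -
    have "dagger (mat 1 :: complex^'x^'x) = mat 1"
      by (auto simp: dagger_def mat_def vec_eq_iff)
    then show ?thesis by (simp add: unitary_def)
  qed
  ultimately obtain W where W: "unitary W" and max: "\<And>Z. unitary Z \<Longrightarrow> ?f Z \<le> ?f W"
    using continuous_attains_sup[OF compact_unitary, of ?f] by auto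
  define P where "P = W ** Y"
  have "psd P"
  proof (rule psd_if_trace_max)
    fix Z :: "complex^'x^'x"
    assume "unitary Z"
    have "dagger (Z ** W) ** (Z ** W) = dagger W ** (dagger Z ** Z) ** W"
      by (simp add: dagger_mult matrix_mul_assoc)
    also have "\<dots> = mat 1" using W \<open>unitary Z\<close> by (simp add: unitary_def)
    finally have "unitary (Z ** W)"
      by (simp add: unitary_def matrix_left_right_inverse)
    \<comment> \<open>\<open>Z ** W\<close> is again a competitor, so maximality of \<open>W\<close>
      for \<open>Y\<close> is maximality of the identity for \<open>P = W ** Y\<close>.\<close>
    from max[OF this] show "Re (trace (Z ** P)) \<le> Re (trace P)"
      by (simp add: P_def matrix_mul_assoc)
  qed
  have "P ** P = dagger P ** P" using psd_dagger[OF \<open>psd P\<close>] by simp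
  also have "\<dots> = dagger Y ** (dagger W ** W) ** Y"
    by (simp add: P_def dagger_mult matrix_mul_assoc)
  also have "\<dots> = dagger Y ** Y" using W by (simp add: unitary_def)
  finally have "psd_sqrt (dagger Y ** Y) = P"
    unfolding psd_sqrt_def using \<open>psd P\<close> by (intro the_equality) (auto intro: psd_sqrt_unique)
  then have "trace_norm Y = ?f W" by (simp add: trace_norm_def P_def)
  then show thesis
    using that[OF W] max \<open>psd P\<close> by (simp add: P_def)
qed

lemma trace_norm_nonneg: "trace_norm Y \<ge> 0"
  by (metis polar_decomposition_max psd_trace complex_nonneg_Reals_iff)

text \<open>A crude bound whose purpose is to make the supremum in \<open>diamond_norm\<close>
  finite; it rests on the entries of a unitary having modulus at most 1.\<close>

lemma trace_norm_le_sum: "trace_norm Y \<le> (\<Sum>i\<in>UNIV. \<Sum>j\<in>UNIV. norm (Y $ i $ j))"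
proof -
  obtain W where W: "unitary W" "trace_norm Y = Re (trace (W ** Y))"
    using polar_decomposition_max by blast
  have "Re (trace (W ** Y)) \<le> norm (\<Sum>j\<in>UNIV. \<Sum>i\<in>UNIV. W $ j $ i * Y $ i $ j)"
    unfolding trace_def matrix_matrix_mult_def vec_lambda_beta by (rule complex_Re_le_cmod)
  also have "\<dots> \<le> (\<Sum>j\<in>UNIV. \<Sum>i\<in>UNIV. norm (W $ j $ i * Y $ i $ j))"
    by (intro order.trans[OF norm_sum] sum_mono norm_sum)
  also have "\<dots> \<le> (\<Sum>j\<in>UNIV. \<Sum>i\<in>UNIV. norm (Y $ i $ j))"
    using unitary_nth_le[OF W(1)]
    by (intro sum_mono) (simp add: norm_mult mult_left_le_one_le)
  also have "\<dots> = (\<Sum>i\<in>UNIV. \<Sum>j\<in>UNIV. norm (Y $ i $ j))" by (rule sum.swap)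
  finally show ?thesis using W by simp
qed

section \<open>Embeddings and partial traces\<close>

definition inclusion :: "('x \<Rightarrow> 'y) \<Rightarrow> complex^'x^'y" where
  "inclusion f = (\<chi> p i. if p = f i then 1 else 0)"

text \<open>Only used for injective \<open>g\<close>, where \<open>'y \<times> 'z\<close> is identified with a set of basis labels.\<close>

definition ptrace :: "('y::finite \<times> 'z::finite \<Rightarrow> 'w::finite) \<Rightarrow> ('w, 'y) superop" where
  "ptrace g X = (\<Sum>z\<in>UNIV. relabel (\<lambda>y. g (y, z)) X)"

lemma ptrace_nth: "ptrace g X $ p $ q = (\<Sum>z\<in>UNIV. X $ g (p, z) $ g (q, z))"
  by (simp add: ptrace_def relabel_def)

lemma inclusion_nth: "inclusion f $ p $ i = of_bool (p = f i)"
  by (simp add: inclusion_def)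

lemma sum_of_bool_eq:
  "(\<Sum>i\<in>UNIV. of_bool (i = k) * f i) = f k" "(\<Sum>i\<in>UNIV. f i * of_bool (i = k)) = f k"
  "(\<Sum>i\<in>UNIV. of_bool (k = i) * f i) = f k" "(\<Sum>i\<in>UNIV. f i * of_bool (k = i)) = f k"
  for f :: "'k::finite \<Rightarrow> complex"
proof -
  have "(\<Sum>i\<in>UNIV. of_bool (i = k) * f i) = (\<Sum>i\<in>UNIV. if i = k then f i else 0)"
    by (intro sum.cong) auto
  then show "(\<Sum>i\<in>UNIV. of_bool (i = k) * f i) = f k" by simp
  then show "(\<Sum>i\<in>UNIV. f i * of_bool (i = k)) = f k"
    "(\<Sum>i\<in>UNIV. of_bool (k = i) * f i) = f k" "(\<Sum>i\<in>UNIV. f i * of_bool (k = i)) = f k"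
    by (simp_all only: mult.commute[of "f _"] eq_commute[of k])
qed

lemma cnj_of_bool: "cnj (of_bool b) = of_bool b"
  by (cases b) simp_all

text \<open>This makes each summand of \<open>ptrace\<close> a Kraus term, from which its complete
  positivity follows.\<close>

lemma relabel_eq_conj_by: "relabel f = conj_by (dagger (inclusion f))"
proof (intro ext)
  fix X :: "'a operator"
  have "relabel f X $ p $ q = conj_by (dagger (inclusion f)) X $ p $ q" for p q
    by (simp add: conj_by_def inclusion_nth dagger_def matrix_matrix_mult_def relabel_def cnj_of_bool
        sum_of_bool_eq)
  then show "relabel f X = conj_by (dagger (inclusion f)) X" by (simp add: vec_eq_iff)
qed

lemma inclusion_isometry: "inj f \<Longrightarrow> dagger (inclusion f) ** inclusion f = mat 1"
  by (simp add: vec_eq_iff inclusion_nth dagger_def matrix_matrix_mult_def mat_def inj_eq cnj_of_bool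
      sum_of_bool_eq)

lemma relabel_inclusion:
  assumes "inj f"
  shows "relabel f (conj_by (inclusion f) X) = X"
proof -
  have "dagger (mat 1 :: complex^'a^'a) = mat 1"
    by (auto simp: dagger_def mat_def vec_eq_iff)
  then show ?thesis
    using inclusion_isometry[OF assms] by (simp add: relabel_eq_conj_by conj_by_mult) (simp add: conj_by_def)
qed

lemma conj_by_inclusion_outside:
  "p \<notin> range f \<or> q \<notin> range f \<Longrightarrow> conj_by (inclusion f) X $ p $ q = 0"
  by (auto simp: conj_by_nth inclusion_nth intro!: sum.neutral)

lemma conj_by_inclusion_image:
  "inj f \<Longrightarrow> conj_by (inclusion f) X $ f i $ f j = X $ i $ j"
  using relabel_inclusion[of f X] by (auto simp: relabel_def vec_eq_iff)

text \<open>Reading an embedded operator at the indices \<open>P p\<close>, \<open>Q q\<close>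
  extracts a block, for instance with ancilla labels fixed. If \<open>J\<close> restricts to
  \<open>f\<close> on that slice, the block is embedded by \<open>f\<close>: an index outside the
  range of \<open>f\<close> is sent outside the range of \<open>J\<close>, so both sides vanish
  there.\<close>

lemma conj_by_inclusion_block:
  assumes "inj J" "inj f"
    and "\<And>x. P (f x) = J (h x)" "\<And>x. Q (f x) = J (k x)"
    and "\<And>p. P p \<in> range J \<Longrightarrow> p \<in> range f" "\<And>p. Q p \<in> range J \<Longrightarrow> p \<in> range f"
  shows "(\<chi> p q. conj_by (inclusion J) X $ P p $ Q q) = conj_by (inclusion f) (\<chi> x y. X $ h x $ k y)"
proof -
  have "conj_by (inclusion J) X $ P p $ Q q = conj_by (inclusion f) (\<chi> x y. X $ h x $ k y) $ p $ q" for p q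
  proof (cases "p \<in> range f \<and> q \<in> range f")
    case True
    then show ?thesis using assms(1-4) by (auto simp: conj_by_inclusion_image)
  next
    case False
    then have "P p \<notin> range J \<or> Q q \<notin> range J" using assms(5,6) by blast
    with False show ?thesis by (simp add: conj_by_inclusion_outside)
  qed
  then show ?thesis by (simp add: vec_eq_iff)
qed

lemma trace_conj_by:
  assumes "dagger K ** K = mat 1"
  shows "trace (conj_by K X) = trace X"
  using trace_mul_sym[of "K ** X" "dagger K"] assms by (simp add: conj_by_def matrix_mul_assoc)

lemma psd_conj_by: "psd X \<Longrightarrow> psd (conj_by K X)"
  by (simp add: psd_def conj_by_def cinner_dagger[of _ K] flip: matrix_vector_mul_assoc)

lemma ptrace_diff: "ptrace g (X - Y) = ptrace g X - ptrace g Y"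
  by (simp add: vec_eq_iff ptrace_nth sum_subtractf)

lemma trace_ptrace:
  assumes "bij g"
  shows "trace (ptrace g X) = trace X"
proof -
  have "trace (ptrace g X) = (\<Sum>p\<in>UNIV. X $ g p $ g p)"
    by (simp add: trace_def ptrace_nth sum_UNIV_prod)
  also have "\<dots> = trace X"
    unfolding trace_def by (rule sum.reindex_bij_betw[OF assms])
  finally show ?thesis .
qed

section \<open>Linearity, complete positivity and channels\<close>

lemma op_linear_conj_by: "op_linear (conj_by K)"
  by (simp add: op_linear_iff vec_eq_iff conj_by_nth op_scale_def sum_distrib_left distrib_right sum.distrib mult.assoc)

lemma op_linear_relabel: "op_linear (relabel f)"
  by (simp add: relabel_eq_conj_by op_linear_conj_by)

lemma op_linear_ptrace: "op_linear (ptrace g)"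
  by (simp add: op_linear_iff vec_eq_iff ptrace_nth op_scale_def sum_distrib_left sum.distrib)

lemma op_linear_tensor_map: "op_linear (tensor_map F G)"
  by (simp add: op_linear_iff vec_eq_iff tensor_map_nth op_scale_def sum_distrib_left distrib_right sum.distrib mult.assoc)

lemma op_linear_id: "op_linear id"
  by (simp add: op_linear_iff)

lemma op_linear_comp: "op_linear F \<Longrightarrow> op_linear G \<Longrightarrow> op_linear (F \<circ> G)"
  by (simp add: op_linear_iff)

lemma op_linear_diff: "op_linear F \<Longrightarrow> op_linear G \<Longrightarrow> op_linear (\<lambda>X. F X - G X)"
  by (simp add: op_linear_iff) (simp add: op_scale_def vec_eq_iff algebra_simps)

lemma completely_positive_conj_by: "completely_positive (conj_by K)"
  unfolding completely_positive_def block_psd_def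
proof (intro allI impI)
  fix n and M :: "nat \<Rightarrow> nat \<Rightarrow> 'a operator" and v :: "nat \<Rightarrow> complex^'b"
  assume "\<forall>v. (\<Sum>i<n. \<Sum>j<n. cinner (v i) (M i j *v v j)) \<in> \<real>\<^sub>\<ge>\<^sub>0"
  from this[rule_format, of "\<lambda>i. dagger K *v v i"]
  show "(\<Sum>i<n. \<Sum>j<n. cinner (v i) (conj_by K (M i j) *v v j)) \<in> \<real>\<^sub>\<ge>\<^sub>0"
    by (simp add: conj_by_def cinner_dagger[of _ K] flip: matrix_vector_mul_assoc)
qed

lemma sum_nonneg_Reals: "(\<And>a. a \<in> A \<Longrightarrow> f a \<in> \<real>\<^sub>\<ge>\<^sub>0) \<Longrightarrow> sum f A \<in> \<real>\<^sub>\<ge>\<^sub>0"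
  for f :: "'k \<Rightarrow> complex"
  by (simp add: complex_nonneg_Reals_iff sum_nonneg)

lemma cinner_sum_mult: "cinner v (sum A S *v w) = (\<Sum>z\<in>S. cinner v (A z *v w))"
  by (induction S rule: infinite_finite_induct)
    (simp_all add: cinner_add_right matrix_vector_mult_add_rdistrib, simp_all add: cinner_def)

lemma completely_positive_ptrace: "completely_positive (ptrace (g :: 'y::finite \<times> 'z::finite \<Rightarrow> 'w::finite))"
  unfolding completely_positive_def
proof (intro allI impI)
  fix n and M :: "nat \<Rightarrow> nat \<Rightarrow> 'w operator"
  assume M: "block_psd n M"
  have *: "block_psd n (\<lambda>i j. relabel (\<lambda>y. g (y, z)) (M i j))" for z
    using completely_positive_conj_by M unfolding relabel_eq_conj_by completely_positive_def by blast
  show "block_psd n (\<lambda>i j. ptrace g (M i j))"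
    unfolding block_psd_def
  proof
    fix v :: "nat \<Rightarrow> complex^'y"
    have "(\<Sum>i<n. \<Sum>j<n. cinner (v i) (ptrace g (M i j) *v v j))
      = (\<Sum>i<n. \<Sum>z\<in>UNIV. \<Sum>j<n. cinner (v i) (relabel (\<lambda>y. g (y, z)) (M i j) *v v j))"
      unfolding ptrace_def cinner_sum_mult by (intro sum.cong refl sum.swap)
    also have "\<dots> = (\<Sum>z\<in>UNIV. \<Sum>i<n. \<Sum>j<n. cinner (v i) (relabel (\<lambda>y. g (y, z)) (M i j) *v v j))"
      by (rule sum.swap)
    finally show "(\<Sum>i<n. \<Sum>j<n. cinner (v i) (ptrace g (M i j) *v v j)) \<in> \<real>\<^sub>\<ge>\<^sub>0"
      using * by (auto simp: block_psd_def intro: sum_nonneg_Reals)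
  qed
qed

lemma channels_comp: "F \<in> channels \<Longrightarrow> G \<in> channels \<Longrightarrow> F \<circ> G \<in> channels"
  by (auto simp: channels_def op_linear_comp completely_positive_def trace_preserving_def)

lemma conj_by_channel: "dagger K ** K = mat 1 \<Longrightarrow> conj_by K \<in> channels"
  by (simp add: channels_def op_linear_conj_by completely_positive_conj_by trace_preserving_def trace_conj_by)

lemma ptrace_channel: "bij g \<Longrightarrow> ptrace g \<in> channels"
  by (simp add: channels_def op_linear_ptrace completely_positive_ptrace trace_preserving_def trace_ptrace)

lemma op_linear_sum:
  assumes "op_linear F"
  shows "F (sum f A) = (\<Sum>a\<in>A. F (f a))"
proof -
  interpret Vector_Spaces.linear op_scale op_scale F
    using assms by (simp add: op_linear_def)
  show ?thesis by (rule sum)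
qed

text \<open>A real infimum over the empty set carries no information. The witness adjoins a register
  in the basis state \<open>y0\<close> and traces out the input: the channel that always prepares
  \<open>y0\<close>.\<close>

lemma channels_nonempty: "(channels :: ('x::finite, 'y::finite) superop set) \<noteq> {}"
proof -
  obtain y0 :: 'y where True by simp
  define J where "J x = (y0, x)" for x :: 'x
  have "inj J" by (simp add: inj_def J_def)
  have "conj_by (inclusion J) \<in> channels" "ptrace (\<lambda>p :: 'y \<times> 'x. p) \<in> channels"
    using inclusion_isometry[OF \<open>inj J\<close>]
    by (auto intro!: conj_by_channel ptrace_channel simp: bij_def inj_def surj_def)
  then show ?thesis using channels_comp by blast
qed

section \<open>Contractivity\<close>

text \<open>A unitary \<open>W\<close> optimal for \<open>ptrace g Y\<close> is extended to the larger space as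
  \<open>W \<otimes> 1\<close> on the range of \<open>g\<close> and as \<open>1\<close> or \<open>-1\<close> on its complement;
  the average of the two extensions has the same pairing with \<open>Y\<close> as \<open>W\<close> with \<open>ptrace g Y\<close>.\<close>

lemma trace_norm_ptrace_le:
  fixes g :: "'y::finite \<times> 'z::finite \<Rightarrow> 'w::finite"
  assumes "inj g"
  shows "trace_norm (ptrace g Y) \<le> trace_norm Y"
proof -
  obtain W where W: "unitary W" "trace_norm (ptrace g Y) = Re (trace (W ** ptrace g Y))"
    using polar_decomposition_max by metis
  define N where "N = {p. p \<notin> range g}"
  \<comment> \<open>Since \<open>g\<close> is injective, at most one triple \<open>(i, j, z)\<close>
    contributes to an entry, so the triple sum is \<open>W \<otimes> 1\<close> written in the labels
    of the larger space.\<close>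
  define E :: "complex \<Rightarrow> complex^'w^'w" where
    "E c = (\<chi> p q. (\<Sum>i\<in>UNIV. \<Sum>j\<in>UNIV. \<Sum>z\<in>UNIV. if p = g (i, z) \<and> q = g (j, z) then W $ i $ j else 0)
       + (if p = q \<and> p \<in> N then c else 0))" for c
  have in_in: "E c $ g (i, z) $ g (j, z') = (if z = z' then W $ i $ j else 0)" for c i j z z'
  proof -
    have "E c $ g (i, z) $ g (j, z') = (\<Sum>i'\<in>UNIV. \<Sum>j'\<in>UNIV. \<Sum>z''\<in>UNIV.
        if g (i, z) = g (i', z'') \<and> g (j, z') = g (j', z'') then W $ i' $ j' else 0)"
      by (simp add: E_def N_def)
    also have "\<dots> = (\<Sum>i'\<in>UNIV. \<Sum>j'\<in>UNIV. \<Sum>z''\<in>UNIV.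
        if z'' = z then (if i' = i \<and> j' = j \<and> z = z' then W $ i $ j else 0) else 0)"
      using assms by (intro sum.cong refl) (auto simp: inj_eq)
    also have "\<dots> = (\<Sum>i'\<in>UNIV. \<Sum>j'\<in>UNIV. if j' = j then (if i' = i \<and> z = z' then W $ i $ j else 0) else 0)"
      by (intro sum.cong refl) simp
    also have "\<dots> = (\<Sum>i'\<in>UNIV. if i' = i then (if z = z' then W $ i $ j else 0) else 0)"
      by (intro sum.cong refl) simp
    finally show ?thesis by simp
  qed
  have out: "E c $ p $ q = (if p = q then c else 0)" if "p \<in> N \<or> q \<in> N" for c p q
    using that by (auto simp: E_def N_def intro!: sum.neutral)
  have split: "(\<Sum>p\<in>UNIV. f p) = (\<Sum>i\<in>UNIV. \<Sum>z\<in>UNIV. f (g (i, z))) + (\<Sum>p\<in>N. f p)" for f :: "'w \<Rightarrow> complex"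
  proof -
    have "(\<Sum>p\<in>UNIV. f p) = (\<Sum>p\<in>range g. f p) + (\<Sum>p\<in>N. f p)"
      by (subst sum.union_disjoint[symmetric]) (auto simp: N_def intro: sum.cong)
    also have "(\<Sum>p\<in>range g. f p) = (\<Sum>i\<in>UNIV. f (g i))"
      using assms by (simp add: sum.reindex)
    finally show ?thesis by (simp add: sum_UNIV_prod)
  qed
  have "unitary (E c)" if c: "cnj c * c = 1" for c
  proof -
    have WW: "(\<Sum>k\<in>UNIV. cnj (W $ k $ i) * W $ k $ j) = (if i = j then 1 else 0)" for i j
    proof -
      have "(dagger W ** W) $ i $ j = mat 1 $ i $ j" using W(1) by (simp add: unitary_def)
      then show ?thesis by (simp add: dagger_def matrix_matrix_mult_def mat_def)
    qed
    have "(dagger (E c) ** E c) $ p $ q = mat 1 $ p $ q" for p q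
    proof (cases "p \<in> N \<or> q \<in> N")
      case True
      have "(dagger (E c) ** E c) $ p $ q = (\<Sum>k\<in>UNIV. cnj (E c $ k $ p) * E c $ k $ q)"
        by (simp add: dagger_def matrix_matrix_mult_def)
      also have "\<dots> = (if p = q then 1 else 0)"
        using True
      proof
        assume p: "p \<in> N"
        then have "(\<Sum>k\<in>UNIV. cnj (E c $ k $ p) * E c $ k $ q) = (\<Sum>k\<in>UNIV. if k = p then cnj c * E c $ p $ q else 0)"
          by (intro sum.cong) (auto simp: out)
        then show ?thesis using p c by (simp add: out)
      next
        assume q: "q \<in> N"
        then have "(\<Sum>k\<in>UNIV. cnj (E c $ k $ p) * E c $ k $ q) = (\<Sum>k\<in>UNIV. if k = q then cnj (E c $ q $ p) * c else 0)"
          by (intro sum.cong) (auto simp: out)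
        then show ?thesis using q c by (simp add: out)
      qed
      finally show ?thesis by (simp add: mat_def)
    next
      case False
      then obtain i z j z' where pq: "p = g (i, z)" "q = g (j, z')"
        by (auto simp: N_def)
      have "(dagger (E c) ** E c) $ p $ q = (\<Sum>k\<in>UNIV. cnj (E c $ k $ p) * E c $ k $ q)"
        by (simp add: dagger_def matrix_matrix_mult_def)
      also have "\<dots> = (\<Sum>k\<in>UNIV. \<Sum>z''\<in>UNIV. cnj (E c $ g (k, z'') $ p) * E c $ g (k, z'') $ q)"
        using False by (subst split) (auto simp: out intro!: sum.neutral)
      also have "\<dots> = (\<Sum>k\<in>UNIV. \<Sum>z''\<in>UNIV. if z'' = z then (if z = z' then cnj (W $ k $ i) * W $ k $ j else 0) else 0)"
        by (intro sum.cong refl) (auto simp: pq in_in)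
      also have "\<dots> = (if z = z' \<and> i = j then 1 else 0)"
        by (cases "z = z'") (simp_all add: WW)
      finally show ?thesis using assms by (auto simp: mat_def pq inj_eq)
    qed
    then have "dagger (E c) ** E c = mat 1" by (simp add: vec_eq_iff)
    then show ?thesis by (simp add: unitary_def matrix_left_right_inverse)
  qed
  then have le: "Re (trace (E c ** Y)) \<le> trace_norm Y" if "cnj c * c = 1" for c
    using that polar_decomposition_max[of Y] by metis
  have tr: "trace (E c ** Y) = trace (W ** ptrace g Y) + c * (\<Sum>p\<in>N. Y $ p $ p)" for c
  proof -
    have "trace (E c ** Y) = (\<Sum>p\<in>UNIV. \<Sum>q\<in>UNIV. E c $ p $ q * Y $ q $ p)"
      by (simp add: trace_def matrix_matrix_mult_def)
    also have "\<dots> = (\<Sum>i\<in>UNIV. \<Sum>z\<in>UNIV. \<Sum>q\<in>UNIV. E c $ g (i, z) $ q * Y $ q $ g (i, z))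
        + (\<Sum>p\<in>N. \<Sum>q\<in>UNIV. E c $ p $ q * Y $ q $ p)"
      by (rule split)
    also have "(\<Sum>p\<in>N. \<Sum>q\<in>UNIV. E c $ p $ q * Y $ q $ p) = (\<Sum>p\<in>N. \<Sum>q\<in>UNIV. if q = p then c * Y $ p $ p else 0)"
      by (intro sum.cong refl) (auto simp: out)
    also have "\<dots> = c * (\<Sum>p\<in>N. Y $ p $ p)" by (simp add: sum_distrib_left)
    also have "(\<Sum>i\<in>UNIV. \<Sum>z\<in>UNIV. \<Sum>q\<in>UNIV. E c $ g (i, z) $ q * Y $ q $ g (i, z))
      = (\<Sum>i\<in>UNIV. \<Sum>z\<in>UNIV. \<Sum>j\<in>UNIV. \<Sum>z'\<in>UNIV. if z' = z then W $ i $ j * Y $ g (j, z) $ g (i, z) else 0)"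
    proof (intro sum.cong refl)
      fix i z
      have "(\<Sum>q\<in>N. E c $ g (i, z) $ q * Y $ q $ g (i, z)) = 0"
        by (intro sum.neutral) (auto simp: out N_def)
      then have "(\<Sum>q\<in>UNIV. E c $ g (i, z) $ q * Y $ q $ g (i, z))
          = (\<Sum>j\<in>UNIV. \<Sum>z'\<in>UNIV. E c $ g (i, z) $ g (j, z') * Y $ g (j, z') $ g (i, z))"
        by (subst split) simp
      also have "\<dots> = (\<Sum>j\<in>UNIV. \<Sum>z'\<in>UNIV. if z' = z then W $ i $ j * Y $ g (j, z) $ g (i, z) else 0)"
        by (intro sum.cong refl) (auto simp: in_in)
      finally show "(\<Sum>q\<in>UNIV. E c $ g (i, z) $ q * Y $ q $ g (i, z))
          = (\<Sum>j\<in>UNIV. \<Sum>z'\<in>UNIV. if z' = z then W $ i $ j * Y $ g (j, z) $ g (i, z) else 0)" .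
    qed
    also have "\<dots> = (\<Sum>i\<in>UNIV. \<Sum>z\<in>UNIV. \<Sum>j\<in>UNIV. W $ i $ j * Y $ g (j, z) $ g (i, z))"
      by simp
    also have "\<dots> = (\<Sum>i\<in>UNIV. \<Sum>j\<in>UNIV. \<Sum>z\<in>UNIV. W $ i $ j * Y $ g (j, z) $ g (i, z))"
      by (intro sum.cong refl sum.swap)
    also have "\<dots> = trace (W ** ptrace g Y)"
      by (simp add: trace_def matrix_matrix_mult_def ptrace_nth sum_distrib_left)
    finally show ?thesis .
  qed
  show ?thesis
    using le[of 1] le[of "-1"] by (simp add: tr W(2))
qed

section \<open>Diamond norm\<close>

text \<open>\<open>tensor_map\<close> is defined through matrix units. With \<open>id\<close> on the
  ancilla the sums over ancilla labels collapse, leaving \<open>M\<close> applied to each ancilla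
  block separately, the form in which inputs can be restricted.\<close>

lemma tensor_map_id_left_nth:
  assumes "op_linear M"
  shows "tensor_map id M X $ p $ q = M (\<chi> k l. X $ (fst p, k) $ (fst q, l)) $ snd p $ snd q"
proof -
  have "tensor_map id M X $ p $ q = (\<Sum>a\<in>UNIV. \<Sum>k\<in>UNIV. \<Sum>b\<in>UNIV. \<Sum>l\<in>UNIV.
      of_bool (a = fst p) * (of_bool (b = fst q) * (X $ (a, k) $ (b, l) * M (op_unit k l) $ snd p $ snd q)))"
    unfolding tensor_map_nth sum_UNIV_prod by (intro sum.cong refl) (auto simp: op_unit_def)
  also have "\<dots> = (\<Sum>k\<in>UNIV. \<Sum>l\<in>UNIV. X $ (fst p, k) $ (fst q, l) * M (op_unit k l) $ snd p $ snd q)"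
    by (simp only: sum_distrib_left[symmetric] sum_of_bool_eq)
  also have "\<dots> = M (\<chi> k l. X $ (fst p, k) $ (fst q, l)) $ snd p $ snd q"
    by (simp add: op_linear_decomp[OF assms, of "\<chi> k l. X $ (fst p, k) $ (fst q, l)"])
  finally show ?thesis .
qed

lemma tensor_map_id_right_nth:
  assumes "op_linear M"
  shows "tensor_map M id X $ p $ q = M (\<chi> k l. X $ (k, snd p) $ (l, snd q)) $ fst p $ fst q"
proof -
  have "tensor_map M id X $ p $ q = (\<Sum>k\<in>UNIV. \<Sum>a\<in>UNIV. \<Sum>l\<in>UNIV. \<Sum>b\<in>UNIV.
      of_bool (a = snd p) * (of_bool (b = snd q) * (X $ (k, a) $ (l, b) * M (op_unit k l) $ fst p $ fst q)))"
    unfolding tensor_map_nth sum_UNIV_prod by (intro sum.cong refl) (auto simp: op_unit_def)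
  also have "\<dots> = (\<Sum>k\<in>UNIV. \<Sum>l\<in>UNIV. X $ (k, snd p) $ (l, snd q) * M (op_unit k l) $ fst p $ fst q)"
    by (simp only: sum_distrib_left[symmetric] sum_of_bool_eq)
  also have "\<dots> = M (\<chi> k l. X $ (k, snd p) $ (l, snd q)) $ fst p $ fst q"
    by (simp add: op_linear_decomp[OF assms, of "\<chi> k l. X $ (k, snd p) $ (l, snd q)"])
  finally show ?thesis .
qed

section \<open>Finiteness of the diamond norm\<close>

lemma states_nonempty: "(states :: 'x::finite operator set) \<noteq> {}"
proof -
  obtain k :: 'x where True by simp
  have "psd (op_unit k k)"
    unfolding psd_def
  proof
    fix v
    have "(op_unit k k *v v) = v $ k *s axis k 1"
      by (auto simp: vec_eq_iff matrix_vector_mult_def op_unit_def axis_def if_distribR if_distrib cong: if_cong)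
    then have "cinner v (op_unit k k *v v) = v $ k * cnj (v $ k)"
      using cinner_axis[of k v] cnj_cinner[of "axis k 1" v] by (simp add: cinner_scale_right)
    then show "cinner v (op_unit k k *v v) \<in> \<real>\<^sub>\<ge>\<^sub>0"
      by (simp flip: complex_norm_square)
  qed
  moreover have "trace (op_unit k k) = 1"
    by (simp add: trace_def op_unit_def)
  ultimately show ?thesis by (auto simp: states_def)
qed

text \<open>For a nonzero off-diagonal entry, positivity is tested on the basis vectors
  \<open>i\<close> and \<open>j\<close>, combined with the phase \<open>c\<close> that turns both
  cross terms into minus the modulus of the entry. So twice the modulus is at most the sum of two
  diagonal entries, which the trace dominates.\<close>

lemma psd_nth_le_trace:
  assumes "psd A"
  shows "norm (A $ i $ j) \<le> Re (trace A)"
proof -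
  have diag: "0 \<le> Re (A $ k $ k)" "Im (A $ k $ k) = 0" for k
    using assms[unfolded psd_def, rule_format, of "axis k 1"]
    by (simp_all add: cinner_axis mult_axis_nth complex_nonneg_Reals_iff)
  then have ndiag: "norm (A $ k $ k) = Re (A $ k $ k)" for k
    by (simp add: cmod_eq_Re)
  have le: "(\<Sum>k\<in>S. Re (A $ k $ k)) \<le> Re (trace A)" for S
    unfolding trace_def Re_sum by (intro sum_mono2) (auto simp: diag(1))
  show ?thesis
  proof (cases "i = j \<or> A $ i $ j = 0")
    case True
    then show ?thesis
    proof
      assume "i = j"
      then show ?thesis using le[of "{i}"] ndiag by simp
    next
      assume "A $ i $ j = 0"
      then show ?thesis using le[of "{}"] by simp
    qed
  next
    case False
    define a where "a = A $ i $ j"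
    define r where "r = complex_of_real (norm a)"
    define c where "c = - cnj a / r"
    have r: "r \<noteq> 0" "a * cnj a = r * r" using False
      by (simp_all add: r_def a_def complex_norm_square[symmetric] power2_eq_square)
    have c: "c * a = - r" "cnj c * cnj a = - r" "c * cnj c = 1"
      using r by (simp_all add: c_def r_def field_simps)
    have "A $ j $ i = cnj a"
      using psd_dagger[OF assms] by (auto simp: a_def dagger_def vec_eq_iff)
    let ?v = "axis i 1 + c *s axis j 1"
    have "cinner ?v (A *v ?v) = A $ i $ i + c * a + cnj c * cnj a + (c * cnj c) * A $ j $ j"
      by (simp add: cinner_add_left cinner_add_right cinner_scale_left cinner_scale_right cinner_axis mult_axis_nth
          matrix_vector_right_distrib vector_scalar_commute \<open>A $ j $ i = cnj a\<close> a_def algebra_simps)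
    also have "\<dots> = A $ i $ i + A $ j $ j - 2 * r" by (simp add: c)
    finally have "0 \<le> Re (A $ i $ i + A $ j $ j - 2 * r)"
      using assms by (metis psd_def complex_nonneg_Reals_iff)
    then have "2 * norm a \<le> Re (A $ i $ i) + Re (A $ j $ j)" by (simp add: r_def)
    also have "\<dots> \<le> Re (trace A)"
      using le[of "{i, j}"] False by simp
    finally show ?thesis using norm_ge_zero[of a] unfolding a_def by linarith
  qed
qed

text \<open>Real suprema can be compared only once boundedness is known. Entries of a state have
  modulus at most 1, so the values of \<open>F\<close> and \<open>G\<close> on matrix units give a
  bound independent of \<open>\<rho>\<close>.\<close>

lemma bdd_above_diamond_norm:
  "bdd_above ((\<lambda>\<rho>. trace_norm (tensor_map F G \<rho>)) ` states)"
proof (rule bdd_aboveI2)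
  fix \<rho> :: "('a \<times> 'b) operator"
  let ?T = "\<lambda>p q i j. F (op_unit (fst i) (fst j)) $ fst p $ fst q * G (op_unit (snd i) (snd j)) $ snd p $ snd q"
  assume "\<rho> \<in> states"
  then have le1: "norm (\<rho> $ i $ j) \<le> 1" for i j
    using psd_nth_le_trace[of \<rho> i j] by (simp add: states_def)
  have "norm (tensor_map F G \<rho> $ p $ q) \<le> (\<Sum>i\<in>UNIV. \<Sum>j\<in>UNIV. norm (?T p q i j))" for p q
  proof -
    have "norm (tensor_map F G \<rho> $ p $ q) \<le> (\<Sum>i\<in>UNIV. \<Sum>j\<in>UNIV. norm (\<rho> $ i $ j * ?T p q i j))"
      unfolding tensor_map_nth by (intro order.trans[OF norm_sum] sum_mono norm_sum)
    also have "\<dots> \<le> (\<Sum>i\<in>UNIV. \<Sum>j\<in>UNIV. norm (?T p q i j))"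
      using le1 unfolding norm_mult[of "\<rho> $ _ $ _"] by (intro sum_mono mult_left_le_one_le) auto
    finally show ?thesis .
  qed
  then have "(\<Sum>p\<in>UNIV. \<Sum>q\<in>UNIV. norm (tensor_map F G \<rho> $ p $ q))
      \<le> (\<Sum>p\<in>UNIV. \<Sum>q\<in>UNIV. \<Sum>i\<in>UNIV. \<Sum>j\<in>UNIV. norm (?T p q i j))"
    by (intro sum_mono)
  then show "trace_norm (tensor_map F G \<rho>) \<le> (\<Sum>p\<in>UNIV. \<Sum>q\<in>UNIV. \<Sum>i\<in>UNIV. \<Sum>j\<in>UNIV. norm (?T p q i j))"
    using trace_norm_le_sum order.trans by blast
qed

lemma diamond_norm_nonneg: "0 \<le> diamond_norm L"
proof -
  obtain \<rho> where "\<rho> \<in> (states :: ('a \<times> 'a) operator set)"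
    using states_nonempty by blast
  then have "trace_norm (tensor_map id L \<rho>) \<le> diamond_norm L"
    unfolding diamond_norm_def by (intro cSUP_upper bdd_above_diamond_norm)
  then show ?thesis using trace_norm_nonneg order.trans by blast
qed

text \<open>A test state for \<open>L\<close> becomes one for \<open>M\<close> by embedding ancilla
  and input both through \<open>J\<close>. The output for \<open>L\<close> is then recovered through
  \<open>h\<close>, which keeps the ancilla labels \<open>J a\<close> and discards the register
  \<open>'z\<close>; this cannot raise the trace norm.\<close>

lemma diamond_norm_restrict:
  fixes J :: "'x::finite \<Rightarrow> 'x1::finite" and g :: "'y::finite \<times> 'z::finite \<Rightarrow> 'y1::finite"
  assumes M: "op_linear M" and J: "inj J" and g: "inj g"
    and L: "\<And>X. L X = ptrace g (M (conj_by (inclusion J) X))"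
  shows "diamond_norm L \<le> diamond_norm M"
  unfolding diamond_norm_def
proof (rule cSUP_least)
  fix \<rho> :: "('x \<times> 'x) operator"
  assume \<rho>: "\<rho> \<in> states"
  have "L = ptrace g \<circ> (M \<circ> conj_by (inclusion J))" using L by auto
  then have linL: "op_linear L"
    by (simp add: op_linear_comp op_linear_conj_by op_linear_ptrace M)
  define JJ where "JJ = map_prod J J"
  have JJ: "inj JJ" using J by (simp add: JJ_def prod.inj_map)
  define h where "h = (\<lambda>((a, y), z). (J a, g (y, z)))"
  have h: "inj h" using J g by (auto simp: h_def inj_def)
  define \<rho>' where "\<rho>' = conj_by (inclusion JJ) \<rho>"
  have \<rho>': "\<rho>' \<in> states"
    using \<rho> by (simp add: \<rho>'_def states_def psd_conj_by trace_conj_by inclusion_isometry JJ)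
  have block: "(\<chi> k l. \<rho>' $ (J a, k) $ (J b, l)) = conj_by (inclusion J) (\<chi> k l. \<rho> $ (a, k) $ (b, l))" for a b
    unfolding \<rho>'_def by (rule conj_by_inclusion_block[OF JJ J]) (auto simp: JJ_def)
  have "tensor_map id L \<rho> = ptrace h (tensor_map id M \<rho>')"
  proof -
    have "tensor_map id L \<rho> $ p $ q = ptrace h (tensor_map id M \<rho>') $ p $ q" for p q
      by (cases p; cases q) (simp add: tensor_map_id_left_nth linL M ptrace_nth h_def block L)
    then show ?thesis by (simp add: vec_eq_iff)
  qed
  then have "trace_norm (tensor_map id L \<rho>) \<le> trace_norm (tensor_map id M \<rho>')"
    using trace_norm_ptrace_le[OF h] by simp
  also have "\<dots> \<le> (SUP \<rho>\<in>(states :: ('x1 \<times> 'x1) operator set). trace_norm (tensor_map id M \<rho>))"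
    using \<rho>' by (rule cSUP_upper[OF _ bdd_above_diamond_norm])
  finally show "trace_norm (tensor_map id L \<rho>)
      \<le> (SUP \<rho>\<in>(states :: ('x1 \<times> 'x1) operator set). trace_norm (tensor_map id M \<rho>))" .
qed (rule states_nonempty)

text \<open>Bijectivity of \<open>g\<close> makes the discarding preserve the trace, so that the
  restricted map is a legitimate competitor.\<close>

lemma channel_restrict:
  assumes "C \<in> channels" "inj J" "bij g"
  shows "ptrace g \<circ> C \<circ> conj_by (inclusion J) \<in> channels"
  using assms by (intro channels_comp ptrace_channel conj_by_channel inclusion_isometry)

text \<open>The pattern shared by both quantities: \<open>L\<close> and \<open>M\<close> are the
  difference maps of the small and the large problem, and each competitor \<open>C\<close> of the
  large one yields a \<open>C'\<close> whose difference map is the restriction of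
  \<open>M C\<close>. The lower bound 0 keeps the infimum over \<open>K'\<close> meaningful.\<close>

lemma INF_diamond_norm_le:
  fixes J :: "'x::finite \<Rightarrow> 'x1::finite" and g :: "'y::finite \<times> 'z::finite \<Rightarrow> 'y1::finite"
  assumes "inj J" "inj g" "K \<noteq> {}"
    and "\<And>C. C \<in> K \<Longrightarrow> \<exists>C'\<in>K'. \<forall>X. L C' X = ptrace g (M C (conj_by (inclusion J) X))"
    and "\<And>C. C \<in> K \<Longrightarrow> op_linear (M C)"
  shows "(INF C\<in>K'. diamond_norm (L C)) \<le> (INF C\<in>K. diamond_norm (M C))"
proof (rule cINF_mono)
  show "bdd_below ((\<lambda>C. diamond_norm (L C)) ` K')"
    by (rule bdd_belowI2[where m = 0]) (rule diamond_norm_nonneg)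
next
  fix C assume "C \<in> K"
  with assms(4) obtain C' where "C' \<in> K'" "\<And>X. L C' X = ptrace g (M C (conj_by (inclusion J) X))"
    by blast
  then show "\<exists>C'\<in>K'. diamond_norm (L C') \<le> diamond_norm (M C)"
    using diamond_norm_restrict[OF assms(5)[OF \<open>C \<in> K\<close>] assms(1,2)] by blast
qed (rule assms(3))

section \<open>Signalling and causal influence\<close>

text \<open>Only diagonal matrix units of the first factor have nonzero trace. \<open>ptrace\<close>
  discards the second component of the argument of \<open>g\<close>, so \<open>prod.swap\<close>
  makes it discard the first factor of the system.\<close>

lemma tensor_map_trace_map_nth:
  assumes "op_linear C"
  shows "tensor_map trace_map C X $ p $ q = C (ptrace prod.swap X) $ snd p $ snd q"
proof -
  have "tensor_map trace_map C X $ p $ q = (\<Sum>a\<in>UNIV. \<Sum>k\<in>UNIV. \<Sum>b\<in>UNIV. \<Sum>l\<in>UNIV.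
      of_bool (b = a) * (X $ (a, k) $ (b, l) * C (op_unit k l) $ snd p $ snd q))"
    unfolding tensor_map_nth sum_UNIV_prod
    by (intro sum.cong refl) (auto simp: trace_map_def trace_def op_unit_def intro!: sum.neutral)
  also have "\<dots> = (\<Sum>a\<in>UNIV. \<Sum>k\<in>UNIV. \<Sum>l\<in>UNIV. X $ (a, k) $ (a, l) * C (op_unit k l) $ snd p $ snd q)"
    by (simp only: sum_distrib_left[symmetric] sum_of_bool_eq)
  also have "\<dots> = (\<Sum>k\<in>UNIV. \<Sum>a\<in>UNIV. \<Sum>l\<in>UNIV. X $ (a, k) $ (a, l) * C (op_unit k l) $ snd p $ snd q)"
    by (rule sum.swap)
  also have "\<dots> = (\<Sum>k\<in>UNIV. \<Sum>l\<in>UNIV. \<Sum>a\<in>UNIV. X $ (a, k) $ (a, l) * C (op_unit k l) $ snd p $ snd q)"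
    by (intro sum.cong refl sum.swap)
  also have "\<dots> = (\<Sum>k\<in>UNIV. \<Sum>l\<in>UNIV. ptrace prod.swap X $ k $ l * C (op_unit k l) $ snd p $ snd q)"
    by (simp add: ptrace_nth sum_distrib_right)
  also have "\<dots> = C (ptrace prod.swap X) $ snd p $ snd q"
    by (simp add: op_linear_decomp[OF assms, of "ptrace prod.swap X"])
  finally show ?thesis .
qed

text \<open>With respect to the factorizations \<open>J\<close> and \<open>g\<close>, the hypothesis says that \<open>B\<close> is the tensor
  product of \<open>A\<close> with an operator whose column at the reference state is the unit vector \<open>l\<close>.\<close>

lemma ptrace_conj_by_product:
  fixes A :: "complex^'x::finite^'y::finite" and l :: "'z::finite \<Rightarrow> complex"
  assumes B: "\<And>y z x. B $ g (y, z) $ J x = A $ y $ x * l z"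
    and l: "(\<Sum>z\<in>UNIV. l z * cnj (l z)) = 1"
  shows "ptrace g (conj_by B (conj_by (inclusion J) X)) = conj_by A X"
proof -
  have BJ: "(B ** inclusion J) $ p $ x = B $ p $ J x" for p x
    by (simp add: matrix_matrix_mult_def inclusion_nth sum_of_bool_eq)
  have "ptrace g (conj_by B (conj_by (inclusion J) X)) $ p $ q = conj_by A X $ p $ q" for p q
  proof -
    have "ptrace g (conj_by B (conj_by (inclusion J) X)) $ p $ q
      = (\<Sum>z\<in>UNIV. \<Sum>i\<in>UNIV. \<Sum>j\<in>UNIV. (l z * cnj (l z)) * (X $ i $ j * (A $ p $ i * cnj (A $ q $ j))))"
      by (simp add: conj_by_mult ptrace_nth conj_by_nth BJ B mult_ac)
    also have "\<dots> = (\<Sum>z\<in>UNIV. l z * cnj (l z)) * conj_by A X $ p $ q"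
      unfolding sum_distrib_left[symmetric] by (simp add: sum_distrib_right[symmetric] conj_by_nth)
    finally show ?thesis by (simp add: l)
  qed
  then show ?thesis by (simp add: vec_eq_iff)
qed

lemma isometry_column:
  assumes "dagger K ** K = mat 1"
  shows "(\<Sum>p\<in>UNIV. K $ p $ q * cnj (K $ p $ q)) = 1"
proof -
  have "(dagger K ** K) $ q $ q = 1" using assms by (simp add: mat_def)
  then show ?thesis by (simp add: dagger_def matrix_matrix_mult_def mult.commute)
qed

lemma signalling_bipartite_tensor_ge:
  fixes U :: "('a1::finite \<times> 'b1::finite, 'c1::finite \<times> 'd1::finite) superop"
    and V :: "('a2::finite \<times> 'b2::finite, 'c2::finite \<times> 'd2::finite) superop"
  assumes "U \<in> unitary_channels" and "V \<in> unitary_channels"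
  shows "signalling U \<le> signalling (bipartite_tensor U V)"
proof -
  obtain K where K: "unitary K" "U = conj_by K" using assms(1) by (auto simp: unitary_channels_def)
  obtain L where L: "unitary L" "V = conj_by L" using assms(2) by (auto simp: unitary_channels_def)
  obtain a0 :: 'a2 and b0 :: 'b2 where True by simp
  define J :: "'a1 \<times> 'b1 \<Rightarrow> ('a1 \<times> 'a2) \<times> ('b1 \<times> 'b2)" where "J = (\<lambda>(a, b). ((a, a0), (b, b0)))"
  define JB :: "'b1 \<Rightarrow> 'b1 \<times> 'b2" where "JB = (\<lambda>b. (b, b0))"
  define g :: "(unit \<times> 'd1) \<times> 'd2 \<Rightarrow> unit \<times> ('d1 \<times> 'd2)" where "g = (\<lambda>((u, d), z). (u, (d, z)))"
  have J: "inj J" and JB: "inj JB" by (auto simp: J_def JB_def inj_def)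
  have g: "inj g" by (auto simp: g_def inj_def)
  have bij_id: "bij (\<lambda>p :: 'd1 \<times> 'd2. p)" by (simp add: bij_def inj_def surj_def)
  have UV: "bipartite_tensor U V = conj_by (bipartite_kron K L)"
    by (simp add: K(2) L(2) bipartite_tensor_conj_by)
  have out: "ptrace g (tensor_map trace_map id (bipartite_tensor U V (conj_by (inclusion J) X)))
      = tensor_map (trace_map :: ('c1, unit) superop) id (U X)" for X
  proof -
    \<comment> \<open>\<open>G\<close> discards the whole output of \<open>V\<close>, both
      \<open>c2\<close> and \<open>d2\<close>, which leaves conjugation by \<open>K\<close>; the
      vector \<open>l\<close> used below is the column of \<open>L\<close> at the reference
      input.\<close>
    define G :: "('c1 \<times> 'd1) \<times> ('c2 \<times> 'd2) \<Rightarrow> ('c1 \<times> 'c2) \<times> ('d1 \<times> 'd2)"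
      where "G = (\<lambda>((c, d), (c2, d2)). ((c, c2), (d, d2)))"
    have "ptrace G (conj_by (bipartite_kron K L) (conj_by (inclusion J) X)) = conj_by K X"
      by (rule ptrace_conj_by_product[where l = "\<lambda>z. L $ z $ (a0, b0)"])
        (use L(1) in \<open>auto simp: G_def J_def bipartite_kron_def isometry_column unitary_def\<close>)
    then have "tensor_map (trace_map :: ('c1, unit) superop) id (U X)
        = tensor_map (trace_map :: ('c1, unit) superop) id (ptrace G (bipartite_tensor U V (conj_by (inclusion J) X)))"
      by (simp only: UV) (simp add: K(2))
    \<comment> \<open>On the left the trace map removes \<open>c\<close> and \<open>c2\<close>
      before \<open>g\<close> removes \<open>d2\<close>; on the right \<open>c2\<close> and
      \<open>d2\<close> go before \<open>c\<close>. Only the order of summation differs.\<close>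
    moreover have "ptrace g (tensor_map trace_map id Y) = tensor_map (trace_map :: ('c1, unit) superop) id (ptrace G Y)" for Y
    proof -
      have "ptrace g (tensor_map trace_map id Y) $ p $ q = tensor_map (trace_map :: ('c1, unit) superop) id (ptrace G Y) $ p $ q" for p q
      proof -
        have "ptrace g (tensor_map trace_map id Y) $ p $ q
            = (\<Sum>z\<in>UNIV. \<Sum>c\<in>UNIV. \<Sum>c2\<in>UNIV. Y $ ((c, c2), (snd p, z)) $ ((c, c2), (snd q, z)))"
          by (cases p; cases q)
            (simp add: ptrace_nth tensor_map_trace_map_nth op_linear_id g_def sum_UNIV_prod)
        also have "\<dots> = (\<Sum>c\<in>UNIV. \<Sum>z\<in>UNIV. \<Sum>c2\<in>UNIV. Y $ ((c, c2), (snd p, z)) $ ((c, c2), (snd q, z)))"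
          by (rule sum.swap)
        also have "\<dots> = (\<Sum>c\<in>UNIV. \<Sum>c2\<in>UNIV. \<Sum>z\<in>UNIV. Y $ ((c, c2), (snd p, z)) $ ((c, c2), (snd q, z)))"
          by (intro sum.cong refl sum.swap)
        also have "\<dots> = tensor_map (trace_map :: ('c1, unit) superop) id (ptrace G Y) $ p $ q"
          by (simp add: ptrace_nth tensor_map_trace_map_nth op_linear_id G_def sum_UNIV_prod)
        finally show ?thesis .
      qed
      then show ?thesis by (simp add: vec_eq_iff)
    qed
    ultimately show ?thesis by simp
  qed
  \<comment> \<open>The embedded input carries \<open>a0\<close> on Alice's second system, so only
    the term \<open>a2 = a0\<close> of the partial trace survives: what remains is Bob's reduced
    input, embedded at \<open>b0\<close>.\<close>
  have inp: "ptrace prod.swap (conj_by (inclusion J) X) = conj_by (inclusion JB) (ptrace prod.swap X)" for X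
  proof -
    have block: "(\<chi> k l. conj_by (inclusion J) X $ ((a, a0), k) $ ((a, a0), l))
        = conj_by (inclusion JB) (relabel (\<lambda>k. (a, k)) X)" for a
      unfolding relabel_def by (rule conj_by_inclusion_block[OF J JB]) (auto simp: J_def JB_def)
    have outside: "conj_by (inclusion J) X $ ((a, a2), k) $ ((a, a2), l) = 0" if "a2 \<noteq> a0" for a a2 k l
      using that by (intro conj_by_inclusion_outside) (auto simp: J_def)
    have "ptrace prod.swap (conj_by (inclusion J) X) $ k $ l = conj_by (inclusion JB) (ptrace prod.swap X) $ k $ l" for k l
    proof -
      have "ptrace prod.swap (conj_by (inclusion J) X) $ k $ l
          = (\<Sum>a\<in>UNIV. \<Sum>a2\<in>UNIV. of_bool (a2 = a0) * conj_by (inclusion J) X $ ((a, a2), k) $ ((a, a2), l))"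
        unfolding ptrace_nth sum_UNIV_prod
        by (intro sum.cong refl) (auto simp: outside)
      also have "\<dots> = (\<Sum>a\<in>UNIV. (\<chi> k l. conj_by (inclusion J) X $ ((a, a0), k) $ ((a, a0), l)) $ k $ l)"
        by (simp add: sum_of_bool_eq)
      also have "\<dots> = conj_by (inclusion JB) (ptrace prod.swap X) $ k $ l"
        unfolding block by (simp add: ptrace_def op_linear_sum[OF op_linear_conj_by])
      finally show ?thesis .
    qed
    then show ?thesis by (simp add: vec_eq_iff)
  qed
  show ?thesis
    unfolding signalling_def
  proof (rule INF_diamond_norm_le[OF J g channels_nonempty])
    fix C :: "('b1 \<times> 'b2, 'd1 \<times> 'd2) superop"
    assume C: "C \<in> channels"
    then have linC: "op_linear C" by (simp add: channels_def)
    show "op_linear (\<lambda>X. tensor_map (trace_map :: ('c1 \<times> 'c2, unit) superop) id (bipartite_tensor U V X)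
        - tensor_map (trace_map :: ('a1 \<times> 'a2, unit) superop) C X)"
      unfolding UV
      by (intro op_linear_diff op_linear_tensor_map op_linear_comp[unfolded comp_def, OF op_linear_tensor_map op_linear_conj_by])
    \<comment> \<open>Prepare \<open>b0\<close>, run \<open>C\<close>, discard \<open>d2\<close>.
      The factorization is the identity because the output type is already
      \<open>'d1 \<times> 'd2\<close>.\<close>
    define C' where "C' = ptrace (\<lambda>p. p) \<circ> C \<circ> conj_by (inclusion JB)"
    have C': "C' \<in> channels" unfolding C'_def by (rule channel_restrict[OF C JB bij_id])
    then have linC': "op_linear C'" by (simp add: channels_def)
    have "ptrace g (tensor_map trace_map C (conj_by (inclusion J) X))
        = tensor_map (trace_map :: ('a1, unit) superop) C' X" for X
    proof -
      have "ptrace g (tensor_map trace_map C (conj_by (inclusion J) X)) $ p $ q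
        = tensor_map (trace_map :: ('a1, unit) superop) C' X $ p $ q" for p q
        unfolding ptrace_nth[of g] tensor_map_trace_map_nth[OF linC] tensor_map_trace_map_nth[OF linC'] inp
        by (cases p; cases q) (simp add: C'_def ptrace_nth g_def)
      then show ?thesis by (simp add: vec_eq_iff)
    qed
    then have "tensor_map (trace_map :: ('c1, unit) superop) id (U X) - tensor_map (trace_map :: ('a1, unit) superop) C' X
      = ptrace g (tensor_map (trace_map :: ('c1 \<times> 'c2, unit) superop) id (bipartite_tensor U V (conj_by (inclusion J) X))
          - tensor_map (trace_map :: ('a1 \<times> 'a2, unit) superop) C (conj_by (inclusion J) X))" for X
      by (simp add: ptrace_diff out)
    then show "\<exists>C'\<in>channels. \<forall>X. tensor_map (trace_map :: ('c1, unit) superop) id (U X)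
          - tensor_map (trace_map :: ('a1, unit) superop) C' X
      = ptrace g (tensor_map (trace_map :: ('c1 \<times> 'c2, unit) superop) id (bipartite_tensor U V (conj_by (inclusion J) X))
          - tensor_map (trace_map :: ('a1 \<times> 'a2, unit) superop) C (conj_by (inclusion J) X))"
      using C' by blast
  qed
qed

text \<open>The matrix of \<open>(1 \<otimes> K)(SWAP \<otimes> 1)(1 \<otimes> dagger K)\<close>.
  The swap ties the two inner labels of \<open>A\<close> to \<open>fst q\<close> and
  \<open>fst p\<close>, so only the sum over \<open>b\<close> remains.\<close>

definition T_matrix :: "complex^('a::finite \<times> 'b::finite)^('c::finite \<times> 'd::finite)
    \<Rightarrow> complex^('a \<times> ('c \<times> 'd))^('a \<times> ('c \<times> 'd))" where
  "T_matrix K = (\<chi> p q. \<Sum>b\<in>UNIV. K $ snd p $ (fst q, b) * cnj (K $ snd q $ (fst p, b)))"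

lemma tensor_map_id_conj_by:
  "tensor_map id (conj_by K) = conj_by (\<chi> p q. of_bool (fst q = fst p) * K $ snd p $ snd q)"
proof -
  have "tensor_map id (conj_by K) X $ p $ q
      = conj_by (\<chi> p q. of_bool (fst q = fst p) * K $ snd p $ snd q) X $ p $ q" for X p q
  proof -
    have "conj_by (\<chi> p q. of_bool (fst q = fst p) * K $ snd p $ snd q) X $ p $ q
      = (\<Sum>a\<in>UNIV. \<Sum>k\<in>UNIV. \<Sum>b\<in>UNIV. \<Sum>l\<in>UNIV. of_bool (a = fst p) * (of_bool (b = fst q) *
           (X $ (a, k) $ (b, l) * (K $ snd p $ k * cnj (K $ snd q $ l)))))"
      unfolding conj_by_nth sum_UNIV_prod by (intro sum.cong refl) (auto simp: cnj_of_bool)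
    also have "\<dots> = (\<Sum>k\<in>UNIV. \<Sum>l\<in>UNIV. X $ (fst p, k) $ (fst q, l) * (K $ snd p $ k * cnj (K $ snd q $ l)))"
      by (simp only: sum_distrib_left[symmetric] sum_of_bool_eq)
    finally show ?thesis
      by (simp add: tensor_map_id_left_nth op_linear_conj_by conj_by_nth)
  qed
  then show ?thesis by (intro ext vec_eq_iff[THEN iffD2] allI)
qed

lemma tensor_swap_eq_relabel:
  "assoc_right \<circ> tensor_map swap_map id \<circ> assoc_left = relabel (\<lambda>(x, (y, z)). (y, (x, z)))"
  (is "?l = ?r")
proof
  fix X
  have "?l X $ p $ q = ?r X $ p $ q" for p q
    by (cases p; cases q) (simp add: assoc_right_def relabel_def[of "\<lambda>(x, y, z). ((x, y), z)"]
        tensor_map_id_right_nth swap_map_def op_linear_relabel, simp add: assoc_left_def relabel_def)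
  then show "?l X = ?r X" by (simp add: vec_eq_iff)
qed

lemma T_channel_conj_by:
  assumes "unitary K"
  shows "T_channel (conj_by K) = conj_by (T_matrix K)"
proof -
  let ?A = "\<lambda>K. (\<chi> p q. of_bool (fst q = fst p) * K $ snd p $ snd q)"
  \<comment> \<open>Permuting labels after a conjugation permutes the rows of the conjugating
    matrix, so the swap is absorbed into the factor of \<open>dagger K\<close>.\<close>
  have rel: "relabel f (conj_by B X) = conj_by (\<chi> p. B $ f p) X" for f B X
    by (simp add: relabel_def vec_eq_iff conj_by_nth)
  have "(?A K ** (\<chi> p. ?A (dagger K) $ (\<lambda>(x, (y, z)). (y, (x, z))) p)) $ p $ q = T_matrix K $ p $ q" for p q
  proof -
    have "(?A K ** (\<chi> p. ?A (dagger K) $ (\<lambda>(x, (y, z)). (y, (x, z))) p)) $ p $ q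
      = (\<Sum>x\<in>UNIV. \<Sum>y\<in>UNIV. \<Sum>b\<in>UNIV. of_bool (x = fst p) * (of_bool (fst q = y) *
           (K $ snd p $ (y, b) * cnj (K $ snd q $ (x, b)))))"
      unfolding matrix_matrix_mult_def by (simp add: sum_UNIV_prod dagger_def mult_ac)
    also have "\<dots> = T_matrix K $ p $ q"
      by (simp only: sum_distrib_left[symmetric] sum_of_bool_eq) (simp add: T_matrix_def)
    finally show ?thesis .
  qed
  then have "?A K ** (\<chi> p. ?A (dagger K) $ (\<lambda>(x, (y, z)). (y, (x, z))) p) = T_matrix K"
    by (simp add: vec_eq_iff)
  then show ?thesis
    by (simp add: T_channel_def tensor_swap_eq_relabel inv_conj_by[OF assms] tensor_map_id_conj_by fun_eq_iff rel conj_by_mult)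
qed

lemma trace_tensor_map_id:
  assumes "op_linear F" "trace_preserving F"
  shows "trace (tensor_map id F X) = trace X"
proof -
  have "trace (tensor_map id F X) = (\<Sum>a\<in>UNIV. trace (F (\<chi> k l. X $ (a, k) $ (a, l))))"
    by (simp add: trace_def sum_UNIV_prod tensor_map_id_left_nth assms(1))
  also have "\<dots> = (\<Sum>a\<in>UNIV. trace (\<chi> k l. X $ (a, k) $ (a, l)))"
    using assms(2) by (simp add: trace_preserving_def)
  also have "\<dots> = trace X" by (simp add: trace_def sum_UNIV_prod)
  finally show ?thesis .
qed

text \<open>Trace preservation is evaluated on the projector \<open>op_unit q q\<close>: its image
  is the rank-one operator of column \<open>q\<close>, whose trace is the squared length of that
  column. This supplies the unit vector required by \<open>ptrace_conj_by_product\<close>.\<close>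

lemma T_matrix_column:
  fixes K :: "complex^('a::finite \<times> 'b::finite)^('c::finite \<times> 'd::finite)"
  assumes "unitary K"
  shows "(\<Sum>p\<in>UNIV. T_matrix K $ p $ q * cnj (T_matrix K $ p $ q)) = 1"
proof -
  have tp: "trace_preserving (conj_by K)" "trace_preserving (conj_by (dagger K))"
    using assms by (simp_all add: trace_preserving_def unitary_def trace_conj_by)
  have bij: "bij (\<lambda>(x :: 'a, (y :: 'a, z :: 'b)). (y, (x, z)))"
    by (rule o_bij[of "\<lambda>(x, (y, z)). (y, (x, z))"]) (auto simp: fun_eq_iff)
  have "trace (relabel (\<lambda>(x, (y, z)). (y, (x, z))) X) = trace X" for X :: "('a \<times> ('a \<times> 'b)) operator"
    unfolding trace_def relabel_def by (simp add: sum.reindex_bij_betw[OF bij, of "\<lambda>p. X $ p $ p"])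
  then have "trace (T_channel (conj_by K) X) = trace X" for X
    by (simp add: T_channel_def tensor_swap_eq_relabel inv_conj_by[OF assms] trace_tensor_map_id op_linear_conj_by tp)
  from this[of "op_unit q q"] show ?thesis
    by (simp add: T_channel_conj_by[OF assms] trace_def conj_by_op_unit) (simp add: op_unit_def)
qed

text \<open>Multiplicativity of T in coordinates: for the product the summed label \<open>b\<close>
  is a pair, and the sum over it factors.\<close>

lemma T_matrix_bipartite_kron:
  "T_matrix (bipartite_kron K L) $ ((a, a'), ((c, c'), (d, d'))) $ ((x, x'), ((y, y'), (z, z')))
    = T_matrix K $ (a, (c, d)) $ (x, (y, z)) * T_matrix L $ (a', (c', d')) $ (x', (y', z'))"
  by (simp add: T_matrix_def bipartite_kron_def sum_UNIV_prod sum_product mult_ac)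

lemma tensor_id_assoc_nth:
  assumes "op_linear C"
  shows "(assoc_right \<circ> tensor_map C id \<circ> assoc_left) X $ (a, (c, d)) $ (a', (c', d'))
    = C (\<chi> k l. X $ (fst k, (snd k, d)) $ (fst l, (snd l, d'))) $ (a, c) $ (a', c')"
  by (simp add: assoc_right_def relabel_def[of "\<lambda>(x, y, z). ((x, y), z)"] tensor_map_id_right_nth[OF assms])
    (simp add: assoc_left_def relabel_def case_prod_unfold)

lemma causal_influence_bipartite_tensor_ge:
  fixes U :: "('a1::finite \<times> 'b1::finite, 'c1::finite \<times> 'd1::finite) superop"
    and V :: "('a2::finite \<times> 'b2::finite, 'c2::finite \<times> 'd2::finite) superop"
  assumes "U \<in> unitary_channels" and "V \<in> unitary_channels"
  shows "causal_influence U \<le> causal_influence (bipartite_tensor U V)"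
proof -
  obtain K where K: "unitary K" "U = conj_by K" using assms(1) by (auto simp: unitary_channels_def)
  obtain L where L: "unitary L" "V = conj_by L" using assms(2) by (auto simp: unitary_channels_def)
  obtain a0 :: 'a2 and c0 :: 'c2 and d0 :: 'd2 where True by simp
  \<comment> \<open>T acts on \<open>A\<close>, \<open>A'\<close> and \<open>B'\<close>, so
    reference labels are fixed for the outputs of \<open>V\<close> as well as for its first
    input.\<close>
  define J :: "'a1 \<times> ('c1 \<times> 'd1) \<Rightarrow> ('a1 \<times> 'a2) \<times> (('c1 \<times> 'c2) \<times> ('d1 \<times> 'd2))"
    where "J = (\<lambda>(a, (c, d)). ((a, a0), ((c, c0), (d, d0))))"
  define g :: "('a1 \<times> ('c1 \<times> 'd1)) \<times> ('a2 \<times> ('c2 \<times> 'd2)) \<Rightarrow> ('a1 \<times> 'a2) \<times> (('c1 \<times> 'c2) \<times> ('d1 \<times> 'd2))"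
    where "g = (\<lambda>((a, (c, d)), (a2, (c2, d2))). ((a, a2), ((c, c2), (d, d2))))"
  define J2 :: "'a1 \<times> 'c1 \<Rightarrow> ('a1 \<times> 'a2) \<times> ('c1 \<times> 'c2)" where "J2 = (\<lambda>(a, c). ((a, a0), (c, c0)))"
  define g2 :: "('a1 \<times> 'c1) \<times> ('a2 \<times> 'c2) \<Rightarrow> ('a1 \<times> 'a2) \<times> ('c1 \<times> 'c2)"
    where "g2 = (\<lambda>((a, c), (a2, c2)). ((a, a2), (c, c2)))"
  have J: "inj J" and J2: "inj J2" and g: "inj g" by (auto simp: J_def J2_def g_def inj_def)
  have g2: "bij g2"
    by (rule o_bij[of "\<lambda>((a, a2), (c, c2)). ((a, c), (a2, c2))"]) (auto simp: fun_eq_iff g2_def)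
  have T_UV: "T_channel (bipartite_tensor U V) = conj_by (T_matrix (bipartite_kron K L))"
    by (simp add: K L bipartite_tensor_conj_by T_channel_conj_by unitary_bipartite_kron)
  have T: "ptrace g (T_channel (bipartite_tensor U V) (conj_by (inclusion J) X)) = T_channel U X" for X
  proof -
    have "ptrace g (conj_by (T_matrix (bipartite_kron K L)) (conj_by (inclusion J) X)) = conj_by (T_matrix K) X"
      by (rule ptrace_conj_by_product[where l = "\<lambda>z. T_matrix L $ z $ (a0, (c0, d0))"])
        (auto simp: g_def J_def T_matrix_bipartite_kron T_matrix_column[OF L(1)])
    then show ?thesis by (simp only: T_UV) (simp add: K T_channel_conj_by)
  qed
  show ?thesis
    unfolding causal_influence_def
  proof (rule INF_diamond_norm_le[OF J g channels_nonempty])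
    fix C :: "(('a1 \<times> 'a2) \<times> ('c1 \<times> 'c2), ('a1 \<times> 'a2) \<times> ('c1 \<times> 'c2)) superop"
    assume C: "C \<in> channels"
    then have linC: "op_linear C" by (simp add: channels_def)
    show "op_linear (\<lambda>X. T_channel (bipartite_tensor U V) X - (assoc_right \<circ> tensor_map C id \<circ> assoc_left) X)"
      unfolding T_UV assoc_right_def assoc_left_def
      by (intro op_linear_diff op_linear_conj_by op_linear_comp op_linear_relabel op_linear_tensor_map)
    define C' where "C' = ptrace g2 \<circ> C \<circ> conj_by (inclusion J2)"
    have C': "C' \<in> channels" unfolding C'_def by (rule channel_restrict[OF C J2 g2])
    then have linC': "op_linear C'" by (simp add: channels_def)
    have "ptrace g ((assoc_right \<circ> tensor_map C id \<circ> assoc_left) (conj_by (inclusion J) X))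
        = (assoc_right \<circ> tensor_map C' id \<circ> assoc_left) X" for X
    proof -
      have C0: "C 0 = 0" using op_linear_sum[OF linC, of _ "{}"] by simp
      \<comment> \<open>\<open>z\<close> labels the second part of Bob's output, on which the
        competitor acts as the identity. It stays at the reference \<open>d0\<close>, so blocks with
        \<open>z \<noteq> d0\<close> are zero and, by \<open>C0\<close>, still zero after
        \<open>C\<close>.\<close>
      have block: "(\<chi> k l. conj_by (inclusion J) X $ (fst k, snd k, (d, z)) $ (fst l, snd l, (d', z)))
          = (if z = d0 then conj_by (inclusion J2) (\<chi> k l. X $ (fst k, snd k, d) $ (fst l, snd l, d')) else 0)" for d d' z
      proof (cases "z = d0")
        case True
        have "(\<chi> k l. conj_by (inclusion J) X $ (fst k, snd k, (d, d0)) $ (fst l, snd l, (d', d0)))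
          = conj_by (inclusion J2) (\<chi> k l. X $ (fst k, snd k, d) $ (fst l, snd l, d'))"
          by (rule conj_by_inclusion_block[OF J J2]) (force simp: J_def J2_def)+
        then show ?thesis using True by simp
      next
        case False
        then have "conj_by (inclusion J) X $ (fst k, snd k, (d, z)) $ (fst l, snd l, (d', z)) = 0" for k l
          by (intro conj_by_inclusion_outside) (auto simp: J_def)
        then show ?thesis using False by (simp add: vec_eq_iff)
      qed
      have "ptrace g ((assoc_right \<circ> tensor_map C id \<circ> assoc_left) (conj_by (inclusion J) X)) $ (a, (c, d)) $ (a', (c', d'))
        = (assoc_right \<circ> tensor_map C' id \<circ> assoc_left) X $ (a, (c, d)) $ (a', (c', d'))" for a c d a' c' d'
      proof -
        define W where "W = C (conj_by (inclusion J2) (\<chi> k l. X $ (fst k, snd k, d) $ (fst l, snd l, d')))"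
        have "ptrace g ((assoc_right \<circ> tensor_map C id \<circ> assoc_left) (conj_by (inclusion J) X)) $ (a, (c, d)) $ (a', (c', d'))
          = (\<Sum>x\<in>UNIV. \<Sum>y\<in>UNIV. \<Sum>z\<in>UNIV. of_bool (z = d0) * W $ ((a, x), (c, y)) $ ((a', x), (c', y)))"
          unfolding ptrace_nth sum_UNIV_prod g_def prod.case tensor_id_assoc_nth[OF linC] block
          by (intro sum.cong refl) (simp add: C0 W_def)
        also have "\<dots> = (assoc_right \<circ> tensor_map C' id \<circ> assoc_left) X $ (a, (c, d)) $ (a', (c', d'))"
          unfolding sum_of_bool_eq tensor_id_assoc_nth[OF linC']
          by (simp add: C'_def ptrace_nth g2_def sum_UNIV_prod W_def)
        finally show ?thesis .
      qed
      then show ?thesis by (simp add: vec_eq_iff split_paired_all)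
    qed
    then have "\<forall>X. T_channel U X - (assoc_right \<circ> tensor_map C' id \<circ> assoc_left) X
      = ptrace g (T_channel (bipartite_tensor U V) (conj_by (inclusion J) X)
          - (assoc_right \<circ> tensor_map C id \<circ> assoc_left) (conj_by (inclusion J) X))"
      by (simp add: ptrace_diff T)
    then show "\<exists>C'\<in>channels. \<forall>X. T_channel U X - (assoc_right \<circ> tensor_map C' id \<circ> assoc_left) X
      = ptrace g (T_channel (bipartite_tensor U V) (conj_by (inclusion J) X)
          - (assoc_right \<circ> tensor_map C id \<circ> assoc_left) (conj_by (inclusion J) X))"
      using C' by blast
  qed
qed

theorem lemma2p3:
  fixes U :: "('a1::finite \<times> 'b1::finite, 'c1::finite \<times> 'd1::finite) superop"
    and V :: "('a2::finite \<times> 'b2::finite, 'c2::finite \<times> 'd2::finite) superop"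
  assumes "U \<in> unitary_channels" and "V \<in> unitary_channels"
  shows "signalling (bipartite_tensor U V) \<ge> signalling U \<and>
         causal_influence (bipartite_tensor U V) \<ge> causal_influence U"
  using signalling_bipartite_tensor_ge[OF assms] causal_influence_bipartite_tensor_ge[OF assms] by blast

end
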